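(* Let $f\colon\mathbb{R}\to\mathbb{R}$. (a) If $f\in\mathcal{LP}_{loc}(\mathbb{R})$ and $f$ is Lebesgue integrable in a neighbourhood of infinity (that is, on $\mathbb{R}\setminus(-a,a)$ for some $a\in(0,\infty)$), then $\widehat{f}$ exists (on $\mathbb{R}$). (b) If $f\in\mathcal{LP}(\mathbb{R})\cap\mathcal{BV}(\pm\infty)$, then $\widehat{f}$ exists on $\mathbb{R}$.
   Context: All integrals are Laplace integrals (complex-valued integrands are treated via real and imaginary parts), defined as follows. Laplace derivates: for a continuous function $U$ on a compact interval and a point $x$ of it, take $\delta>0$ small and put $\underline{LD}_1^{+}U(x)=\liminf_{s\to\infty}s^2\int_0^\delta e^{-st}[U(x+t)-U(x)]\,dt$ and $\underline{LD}_1^{-}U(x)=\liminf_{s\to\infty}(-s^2)\int_0^\delta e^{-st}[U(x-t)-U(x)]\,dt$ (these do not depend on $\delta$); $\underline{LD}_1U(x)$ is the minimum of the two. $\overline{LD}_1U(x)$ is defined with $\limsup$ and maximum. At endpoints only the available one-sided expression is used. Laplace integral on a compact interval $[p,q]\subset\mathbb{R}$: for $f:[p,q]\to\mathbb{R}$, a major (resp. minor) function is a continuous $U$ (resp. $V$) on $[p,q]$ with $\underline{LD}_1U\ge f$, $\underline{LD}_1U>-\infty$ (resp. $\overline{LD}_1V\le f$, $\overline{LD}_1V<\infty$) everywhere on $[p,q]$. $f$ is Laplace integrable on $[p,q]$ if it has major and minor functions and $\inf_U(U(q)-U(p))=\sup_V(V(q)-V(p))$ is finite; the common value is $\int_p^q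 f$. Unbounded intervals: $f$ is Laplace integrable on $[p,\infty)$, $p\in\mathbb{R}$, if it is Laplace integrable on $[p,c]$ for all $c\ge p$ and $\int_p^\infty f:=\lim_{c\to\infty}\int_p^c f$ exists (finite); similarly on $(-\infty,q]$. It is integrable on $\mathbb{R}$ if for some $p\in\mathbb{R}$ it is integrable on $(-\infty,p]$ and $[p,\infty)$, and then $\int_{-\infty}^\infty f=\int_{-\infty}^p f+\int_p^\infty f$. $\mathcal{LP}(\mathbb{R})$ is the set of Laplace integrable functions on $\mathbb{R}$ and $\mathcal{LP}_{loc}(\mathbb{R})$ the set of locally Laplace integrable functions (Laplace integrable on every compact interval). $\mathcal{BV}(\pm\infty)$: functions of bounded variation on $\mathbb{R}\setminus(-a,a)$ for some $a\in\mathbb{R}$. Fourier transform: $\widehat{f}(y)=\int_{-\infty}^\infty f(x)e^{-2\pi iyx}\,dx$ (Laplace integral), provided the integral exists. *)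

theory Defs
  imports "HOL-Analysis.Analysis"
begin

section \<open>Laplace derivates\<close>

definition lower_LD_right :: "real \<Rightarrow> (real \<Rightarrow> real) \<Rightarrow> real \<Rightarrow> ereal" where
  "lower_LD_right \<delta> U x =
     Liminf at_top (\<lambda>s. ereal (s\<^sup>2 * integral {0..\<delta>} (\<lambda>t. exp (- (s * t)) * (U (x + t) - U x))))"

definition lower_LD_left :: "real \<Rightarrow> (real \<Rightarrow> real) \<Rightarrow> real \<Rightarrow> ereal" where
  "lower_LD_left \<delta> U x =
     Liminf at_top (\<lambda>s. ereal (- s\<^sup>2 * integral {0..\<delta>} (\<lambda>t. exp (- (s * t)) * (U (x - t) - U x))))"

definition upper_LD_right :: "real \<Rightarrow> (real \<Rightarrow> real) \<Rightarrow> real \<Rightarrow> ereal" where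
  "upper_LD_right \<delta> U x =
     Limsup at_top (\<lambda>s. ereal (s\<^sup>2 * integral {0..\<delta>} (\<lambda>t. exp (- (s * t)) * (U (x + t) - U x))))"

definition upper_LD_left :: "real \<Rightarrow> (real \<Rightarrow> real) \<Rightarrow> real \<Rightarrow> ereal" where
  "upper_LD_left \<delta> U x =
     Limsup at_top (\<lambda>s. ereal (- s\<^sup>2 * integral {0..\<delta>} (\<lambda>t. exp (- (s * t)) * (U (x - t) - U x))))"

text \<open>
  For continuous \<open>U\<close> the one-sided derivates do not depend on \<open>\<delta>\<close> (lemma \<open>LD_delta_indep\<close> below),
  so we take the largest \<open>\<delta>\<close> for which the integrand stays inside \<open>[p, q]\<close>.
  A side that is not available at an endpoint contributes the neutral element of the minimum
  (maximum).
\<close>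

definition lower_LD :: "real \<Rightarrow> real \<Rightarrow> (real \<Rightarrow> real) \<Rightarrow> real \<Rightarrow> ereal" where
  "lower_LD p q U x =
     min (if x < q then lower_LD_right (q - x) U x else \<infinity>)
         (if p < x then lower_LD_left (x - p) U x else \<infinity>)"

definition upper_LD :: "real \<Rightarrow> real \<Rightarrow> (real \<Rightarrow> real) \<Rightarrow> real \<Rightarrow> ereal" where
  "upper_LD p q U x =
     max (if x < q then upper_LD_right (q - x) U x else - \<infinity>)
         (if p < x then upper_LD_left (x - p) U x else - \<infinity>)"

lemma Liminf_perturb_le:
  fixes f g :: "real \<Rightarrow> real"
  assumes "((\<lambda>s. g s - f s) \<longlongrightarrow> 0) at_top"
  shows "Liminf at_top (\<lambda>s. ereal (f s)) \<le> Liminf at_top (\<lambda>s. ereal (g s))"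
  unfolding le_Liminf_iff
proof (intro allI impI)
  fix y assume y: "y < Liminf at_top (\<lambda>s. ereal (f s))"
  show "\<forall>\<^sub>F s in at_top. y < ereal (g s)"
  proof (cases "y = -\<infinity>")
    case False
    obtain z where z: "y < z" "z < Liminf at_top (\<lambda>s. ereal (f s))"
      using y dense by blast
    from z False obtain z' where z': "z = ereal z'" by (cases z) auto
    from y False z obtain y' where y': "y = ereal y'" by (cases y) auto
    have "\<forall>\<^sub>F s in at_top. z < ereal (f s)"
      using z(2) by (rule less_LiminfD)
    moreover have "\<forall>\<^sub>F s in at_top. dist (g s - f s) 0 < z' - y'"
      using tendstoD[OF assms] z(1) z' y' by simp
    ultimately show ?thesis
      by eventually_elim (auto simp: z' y' dist_real_def)
  qed auto
qed

lemma Liminf_perturb: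
  fixes f g :: "real \<Rightarrow> real"
  assumes "((\<lambda>s. g s - f s) \<longlongrightarrow> 0) at_top"
  shows "Liminf at_top (\<lambda>s. ereal (f s)) = Liminf at_top (\<lambda>s. ereal (g s))"
  using Liminf_perturb_le[OF assms] Liminf_perturb_le[of f g] tendsto_minus[OF assms]
  by (intro antisym) auto

lemma Limsup_perturb:
  fixes f g :: "real \<Rightarrow> real"
  assumes "((\<lambda>s. g s - f s) \<longlongrightarrow> 0) at_top"
  shows "Limsup at_top (\<lambda>s. ereal (f s)) = Limsup at_top (\<lambda>s. ereal (g s))"
proof -
  have "((\<lambda>s. - g s - - f s) \<longlongrightarrow> 0) at_top"
    using tendsto_minus[OF assms] by simp
  from Liminf_perturb[OF this] show ?thesis
    using ereal_Liminf_uminus[of at_top "\<lambda>s. ereal (f s)"]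
      ereal_Liminf_uminus[of at_top "\<lambda>s. ereal (g s)"] by simp
qed

lemma Laplace_tail_vanishes:
  fixes h :: "real \<Rightarrow> real"
  assumes "0 < d" "d \<le> e" and h: "continuous_on {0..e} h"
  shows "((\<lambda>s. s\<^sup>2 * integral {0..e} (\<lambda>t. exp (- (s * t)) * h t)
            - s\<^sup>2 * integral {0..d} (\<lambda>t. exp (- (s * t)) * h t)) \<longlongrightarrow> 0) at_top"
proof -
  obtain M where M: "\<And>t. t \<in> {0..e} \<Longrightarrow> \<bar>h t\<bar> \<le> M"
    using compact_imp_bounded[OF compact_continuous_image[OF h compact_Icc]]
    unfolding bounded_iff by (metis image_eqI real_norm_def)
  have int: "(\<lambda>t. exp (- (s * t)) * h t) integrable_on {0..e}" for s
    by (intro integrable_continuous_real continuous_intros h)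
  have split: "integral {0..e} (\<lambda>t. exp (- (s * t)) * h t)
      - integral {0..d} (\<lambda>t. exp (- (s * t)) * h t) = integral {d..e} (\<lambda>t. exp (- (s * t)) * h t)" for s
    using Henstock_Kurzweil_Integration.integral_combine[OF _ assms(2) int[of s]] assms by simp
  have bnd: "norm (integral {d..e} (\<lambda>t. exp (- (s * t)) * h t)) \<le> exp (- (s * d)) * M * (e - d)"
    if "s \<ge> 0" for s
  proof (rule integral_bound[OF assms(2)])
    show "continuous_on {d..e} (\<lambda>t. exp (- (s * t)) * h t)"
      using assms by (intro continuous_intros continuous_on_subset[OF h]) auto
    show "norm (exp (- (s * t)) * h t) \<le> exp (- (s * d)) * M" if "t \<in> {d..e}" for t
      using that assms \<open>s \<ge> 0\<close> M[of t]
      by (auto simp: abs_mult intro!: mult_mono mult_left_mono)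
  qed
  have "((\<lambda>s. s\<^sup>2 * exp (- (s * d)) * (M * (e - d))) \<longlongrightarrow> 0 * (M * (e - d))) at_top"
  proof (rule tendsto_mult_right)
    have "((\<lambda>s. s ^ 2 / exp s) \<longlongrightarrow> (0::real)) at_top" by (rule tendsto_power_div_exp_0)
    moreover have "filterlim (\<lambda>s. d * s) at_top at_top"
      using assms(1) by (intro filterlim_tendsto_pos_mult_at_top[OF tendsto_const _ filterlim_ident])
    ultimately have "((\<lambda>s. (d * s) ^ 2 / exp (d * s)) \<longlongrightarrow> (0::real)) at_top"
      by (rule filterlim_compose)
    from tendsto_mult_left[OF this, of "1 / d\<^sup>2"]
    show "((\<lambda>s. s\<^sup>2 * exp (- (s * d))) \<longlongrightarrow> 0) at_top"
      using assms(1) by (simp add: exp_minus field_simps power_mult_distrib)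
  qed
  then have lim: "((\<lambda>s. s\<^sup>2 * exp (- (s * d)) * (M * (e - d))) \<longlongrightarrow> 0) at_top" by simp
  show ?thesis
  proof (rule Lim_null_comparison[OF _ lim])
    show "\<forall>\<^sub>F s in at_top. norm (s\<^sup>2 * integral {0..e} (\<lambda>t. exp (- (s * t)) * h t)
            - s\<^sup>2 * integral {0..d} (\<lambda>t. exp (- (s * t)) * h t))
            \<le> s\<^sup>2 * exp (- (s * d)) * (M * (e - d))"
      using eventually_ge_at_top[of 0]
    proof eventually_elim
      case (elim s)
      have "s\<^sup>2 * \<bar>integral {d..e} (\<lambda>t. exp (- (s * t)) * h t)\<bar>
          \<le> s\<^sup>2 * (exp (- (s * d)) * M * (e - d))"
        using bnd[OF elim] by (intro mult_left_mono) auto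
      then show ?case
        unfolding right_diff_distrib[symmetric] split by (simp add: abs_mult mult_ac)
    qed
  qed
qed

lemma LD_delta_indep:
  assumes "0 < d" "d \<le> e"
  shows "continuous_on {x..x + e} U \<Longrightarrow> lower_LD_right d U x = lower_LD_right e U x"
    and "continuous_on {x..x + e} U \<Longrightarrow> upper_LD_right d U x = upper_LD_right e U x"
    and "continuous_on {x - e..x} U \<Longrightarrow> lower_LD_left d U x = lower_LD_left e U x"
    and "continuous_on {x - e..x} U \<Longrightarrow> upper_LD_left d U x = upper_LD_left e U x"
proof -
  have r: "continuous_on {0..e} (\<lambda>t. U (x + t) - U x)" if "continuous_on {x..x + e} U"
    by (intro continuous_intros continuous_on_compose2[OF that]) auto
  have l: "continuous_on {0..e} (\<lambda>t. U (x - t) - U x)" if "continuous_on {x - e..x} U"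
    by (intro continuous_intros continuous_on_compose2[OF that]) auto
  show "continuous_on {x..x + e} U \<Longrightarrow> lower_LD_right d U x = lower_LD_right e U x"
    unfolding lower_LD_right_def
    using Liminf_perturb[OF Laplace_tail_vanishes[OF assms r]] by simp
  show "continuous_on {x..x + e} U \<Longrightarrow> upper_LD_right d U x = upper_LD_right e U x"
    unfolding upper_LD_right_def
    using Limsup_perturb[OF Laplace_tail_vanishes[OF assms r]] by simp
  have l': "((\<lambda>s. - s\<^sup>2 * integral {0..e} (\<lambda>t. exp (- (s * t)) * (U (x - t) - U x))
      - - s\<^sup>2 * integral {0..d} (\<lambda>t. exp (- (s * t)) * (U (x - t) - U x))) \<longlongrightarrow> 0) at_top"
    if "continuous_on {x - e..x} U"
    using tendsto_minus[OF Laplace_tail_vanishes[OF assms l[OF that]]] by simp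
  show "continuous_on {x - e..x} U \<Longrightarrow> lower_LD_left d U x = lower_LD_left e U x"
    unfolding lower_LD_left_def by (rule Liminf_perturb[OF l'])
  show "continuous_on {x - e..x} U \<Longrightarrow> upper_LD_left d U x = upper_LD_left e U x"
    unfolding upper_LD_left_def by (rule Limsup_perturb[OF l'])
qed

section \<open>The Laplace integral\<close>

definition Laplace_major :: "(real \<Rightarrow> real) \<Rightarrow> real \<Rightarrow> real \<Rightarrow> (real \<Rightarrow> real) \<Rightarrow> bool" where
  "Laplace_major f p q U \<longleftrightarrow> continuous_on {p..q} U \<and>
     (\<forall>x\<in>{p..q}. lower_LD p q U x \<ge> ereal (f x) \<and> lower_LD p q U x > - \<infinity>)"

definition Laplace_minor :: "(real \<Rightarrow> real) \<Rightarrow> real \<Rightarrow> real \<Rightarrow> (real \<Rightarrow> real) \<Rightarrow> bool" where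
  "Laplace_minor f p q V \<longleftrightarrow> continuous_on {p..q} V \<and>
     (\<forall>x\<in>{p..q}. upper_LD p q V x \<le> ereal (f x) \<and> upper_LD p q V x < \<infinity>)"

text \<open>\<open>I :: real\<close> encodes the finiteness of the common value of infimum and supremum.\<close>

definition has_Laplace_integral :: "(real \<Rightarrow> real) \<Rightarrow> real \<Rightarrow> real \<Rightarrow> real \<Rightarrow> bool" where
  "has_Laplace_integral f p q I \<longleftrightarrow>
     (\<exists>U. Laplace_major f p q U) \<and> (\<exists>V. Laplace_minor f p q V) \<and>
     (INF U\<in>{U. Laplace_major f p q U}. ereal (U q - U p)) = ereal I \<and>
     (SUP V\<in>{V. Laplace_minor f p q V}. ereal (V q - V p)) = ereal I"

definition Laplace_integrable :: "(real \<Rightarrow> real) \<Rightarrow> real \<Rightarrow> real \<Rightarrow> bool" where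
  "Laplace_integrable f p q \<longleftrightarrow> (\<exists>I. has_Laplace_integral f p q I)"

definition Laplace_integral :: "(real \<Rightarrow> real) \<Rightarrow> real \<Rightarrow> real \<Rightarrow> real" where
  "Laplace_integral f p q = (THE I. has_Laplace_integral f p q I)"

definition has_Laplace_integral_atLeast :: "(real \<Rightarrow> real) \<Rightarrow> real \<Rightarrow> real \<Rightarrow> bool" where
  "has_Laplace_integral_atLeast f p I \<longleftrightarrow>
     (\<forall>c\<ge>p. Laplace_integrable f p c) \<and> ((\<lambda>c. Laplace_integral f p c) \<longlongrightarrow> I) at_top"

definition has_Laplace_integral_atMost :: "(real \<Rightarrow> real) \<Rightarrow> real \<Rightarrow> real \<Rightarrow> bool" where
  "has_Laplace_integral_atMost f q I \<longleftrightarrow>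
     (\<forall>c\<le>q. Laplace_integrable f c q) \<and> ((\<lambda>c. Laplace_integral f c q) \<longlongrightarrow> I) at_bot"

definition has_Laplace_integral_UNIV :: "(real \<Rightarrow> real) \<Rightarrow> real \<Rightarrow> bool" where
  "has_Laplace_integral_UNIV f I \<longleftrightarrow>
     (\<exists>p A B. has_Laplace_integral_atMost f p A \<and> has_Laplace_integral_atLeast f p B \<and> I = A + B)"

definition has_complex_Laplace_integral_UNIV :: "(real \<Rightarrow> complex) \<Rightarrow> complex \<Rightarrow> bool" where
  "has_complex_Laplace_integral_UNIV g w \<longleftrightarrow>
     has_Laplace_integral_UNIV (\<lambda>x. Re (g x)) (Re w) \<and>
     has_Laplace_integral_UNIV (\<lambda>x. Im (g x)) (Im w)"

definition LP :: "(real \<Rightarrow> real) set" where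
  "LP = {f. \<exists>I. has_Laplace_integral_UNIV f I}"

definition LP_loc :: "(real \<Rightarrow> real) set" where
  "LP_loc = {f. \<forall>p q. p \<le> q \<longrightarrow> Laplace_integrable f p q}"

section \<open>Bounded variation at infinity\<close>

definition bounded_variation_on :: "real set \<Rightarrow> (real \<Rightarrow> real) \<Rightarrow> bool" where
  "bounded_variation_on S f \<longleftrightarrow>
     (\<exists>B. \<forall>n x. (\<forall>i\<le>n. x i \<in> S) \<and> (\<forall>i<n. x i \<le> x (Suc i)) \<longrightarrow>
        (\<Sum>i<n. \<bar>f (x (Suc i)) - f (x i)\<bar>) \<le> B)"

definition BV_infinity :: "(real \<Rightarrow> real) set" where
  "BV_infinity = {f. \<exists>a. bounded_variation_on (UNIV - {-a<..<a}) f}"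

section \<open>Fourier transform\<close>

definition has_Fourier_transform :: "(real \<Rightarrow> real) \<Rightarrow> real \<Rightarrow> complex \<Rightarrow> bool" where
  "has_Fourier_transform f y w \<longleftrightarrow>
     has_complex_Laplace_integral_UNIV
       (\<lambda>x. complex_of_real (f x) * exp (- 2 * complex_of_real pi * \<i> * complex_of_real y * complex_of_real x)) w"

end

theory Submission
  imports Defs
begin

text \<open>
  The Fourier integral splits into a local question, integrability of \<open>f\<close> times a sine or cosine on
  compact intervals, and a question about convergence of the tails.

  Locally, a product of a Laplace integrable \<open>f\<close> with a nonnegative continuously differentiable \<open>G\<close> is
  integrable, because integration by parts turns a major function \<open>U\<close> of \<open>f\<close> into the major
  function \<open>U G - \<integral> U G'\<close> of \<open>f G\<close> (lemmas \<open>Laplace_major_mult\<close> and \<open>Laplace_integrable_mult\<close>).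
  Adding \<open>1\<close> to the sine makes it nonnegative.  What has to be known about the integral itself rests on
  one comparison principle, \<open>increment_le_if_lower_LD_right\<close>: a continuous function with positive
  right lower derivate attains its maximum at the right endpoint.

  For the tails the Laplace integral is compared with the Lebesgue integral.  If \<open>h \<le> g\<close> and \<open>g\<close> is
  bounded below and integrable in the classical sense, then the Laplace integral of \<open>h\<close> is at most
  that of \<open>g\<close> (lemma \<open>Laplace_integral_le_integral\<close>): the layer cake decomposition of \<open>g\<close>
  over slightly enlarged open superlevel sets supplies a continuous function that dominates every minor
  function of \<open>h\<close> and whose increment is almost the integral of \<open>g\<close>.

  In part (a) the tails of \<open>f sin\<close> are then bounded by those of the Lebesgue integral of \<open>\<bar>f\<bar>\<close>.
  In part (b) the function is bounded near infinity, so its tails there may be computed as classical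
  integrals; \<open>f\<close> tends to \<open>0\<close> since it has a limit and is integrable, hence it is a difference of
  monotone functions tending to \<open>0\<close>, and Dirichlet's test applies for \<open>y \<noteq> 0\<close>.  The frequency
  \<open>y = 0\<close> is integrability of \<open>f\<close> itself.  The tails at \<open>- \<infinity>\<close> follow by reflection.
\<close>

section \<open>Real lower bounds on Laplace derivates\<close>

definition Laplace_quotient :: "real \<Rightarrow> (real \<Rightarrow> real) \<Rightarrow> real \<Rightarrow> real \<Rightarrow> real" where
  "Laplace_quotient e U x s = s\<^sup>2 * integral {0..e} (\<lambda>t. exp (- (s * t)) * (U (x + t) - U x))"

text \<open>
  Sums and multiples of extended-real lower limits are awkward because of \<open>\<infinity> - \<infinity>\<close>.
  Since only real lower bounds on derivates matter, such bounds are expressed by eventual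
  inequalities between reals, which can be added and scaled.
\<close>

lemma ereal_le_lower_LD_right_iff:
  "ereal c \<le> lower_LD_right e U x \<longleftrightarrow>
     (\<forall>\<eta>>0. \<forall>\<^sub>F s in at_top. c - \<eta> \<le> Laplace_quotient e U x s)"
proof
  assume c: "ereal c \<le> lower_LD_right e U x"
  show "\<forall>\<eta>>0. \<forall>\<^sub>F s in at_top. c - \<eta> \<le> Laplace_quotient e U x s"
  proof (intro allI impI)
    fix \<eta> :: real assume "\<eta> > 0"
    then have "ereal (c - \<eta>) < ereal c" by simp
    also note c
    finally have "ereal (c - \<eta>) < lower_LD_right e U x" .
    from less_LiminfD[OF this[unfolded lower_LD_right_def]]
    show "\<forall>\<^sub>F s in at_top. c - \<eta> \<le> Laplace_quotient e U x s"
      by eventually_elim (simp add: Laplace_quotient_def)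
  qed
next
  assume *: "\<forall>\<eta>>0. \<forall>\<^sub>F s in at_top. c - \<eta> \<le> Laplace_quotient e U x s"
  have "ereal c \<le> lower_LD_right e U x + ereal \<eta>" if "\<eta> > 0" for \<eta> :: real
  proof -
    have "ereal (c - \<eta>) \<le> lower_LD_right e U x"
      unfolding lower_LD_right_def
      by (rule Liminf_bounded, rule eventually_mono[OF *[rule_format, OF that]])
        (simp add: Laplace_quotient_def)
    then show ?thesis
      by (cases "lower_LD_right e U x") auto
  qed
  then show "ereal c \<le> lower_LD_right e U x"
    by (rule ereal_le_epsilon2)
qed

text \<open>
  The two sign changes in the left derivate are exactly those produced by the point reflection
  \<open>U \<mapsto> (\<lambda>z. - U (- z))\<close> of the graph, which therefore exchanges left and right derivates.
  Hence every statement about left derivates reduces to one about right derivates.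
\<close>

lemma lower_LD_reflect: "lower_LD p q U x = lower_LD (- q) (- p) (\<lambda>z. - U (- z)) (- x)"
proof -
  have "lower_LD_left e W z = lower_LD_right e (\<lambda>y. - W (- y)) (- z)" for e W z
  proof -
    have "(- s\<^sup>2) * integral {0..e} (\<lambda>t. exp (- (s * t)) * (W (z - t) - W z))
        = s\<^sup>2 * integral {0..e} (\<lambda>t. - (exp (- (s * t)) * (W (z - t) - W z)))" for s
      by (subst integral_neg) simp
    then show ?thesis
      unfolding lower_LD_left_def lower_LD_right_def by (simp add: algebra_simps)
  qed
  then show ?thesis
    unfolding lower_LD_def by (simp add: min.commute)
qed

text \<open>
  The upper derivate needs no theory of its own: minor functions of \<open>f\<close> will be handled as
  negatives of major functions of \<open>- f\<close>.
\<close>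

lemma upper_LD_uminus: "upper_LD p q U x = - lower_LD p q (\<lambda>z. - U z) x"
proof -
  have "integral {0..e} (\<lambda>t. exp (- (s * t)) * (- U (g t) - - U x))
      = - integral {0..e} (\<lambda>t. exp (- (s * t)) * (U (g t) - U x))" for g :: "real \<Rightarrow> real" and e s
    by (subst integral_neg[symmetric]) (simp add: algebra_simps)
  note * = this
  have r: "upper_LD_right e U x = - lower_LD_right e (\<lambda>z. - U z) x" for e
    unfolding upper_LD_right_def lower_LD_right_def * ereal_Limsup_uminus[symmetric] by simp
  have l: "upper_LD_left e U x = - lower_LD_left e (\<lambda>z. - U z) x" for e
    unfolding upper_LD_left_def lower_LD_left_def * ereal_Limsup_uminus[symmetric] by simp
  have m: "- min a b = max (- a) (- b)" for a b :: ereal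
    using linear[of a b] by (auto simp: min_def max_def)
  show ?thesis
    unfolding upper_LD_def lower_LD_def m by (simp add: r l)
qed

lemma ereal_le_lower_LD_iff:
  "ereal c \<le> lower_LD p q U x \<longleftrightarrow>
    (x < q \<longrightarrow> ereal c \<le> lower_LD_right (q - x) U x) \<and>
    (p < x \<longrightarrow> ereal c \<le> lower_LD_right (x - p) (\<lambda>z. - U (- z)) (- x))"
proof -
  have "lower_LD_left (x - p) U x = lower_LD_right (x - p) (\<lambda>z. - U (- z)) (- x)" if "p < x"
    using lower_LD_reflect[of p x U x] that by (simp add: lower_LD_def)
  then show ?thesis
    by (auto simp: lower_LD_def)
qed

text \<open>
  The kernel \<open>s\<^sup>2 t exp (- s t)\<close> is a probability density on \<open>[0, \<infinity>)\<close> that concentrates at \<open>0\<close> as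
  \<open>s \<rightarrow> \<infinity>\<close>: it has mass \<open>1 - exp (- s d) (s d + 1)\<close> on \<open>[0, d]\<close>.  The quotient averages the
  difference quotients of \<open>U\<close> at \<open>x\<close> against this density, so a lower bound for them near \<open>x\<close>
  is a lower bound for the limit; what lies beyond \<open>d\<close> is negligible.
\<close>

lemma Laplace_quotient_ge_slope:
  assumes cont: "continuous_on {x..x + e} U" and d: "0 < d" "d \<le> e"
    and slope: "\<And>t. 0 \<le> t \<Longrightarrow> t \<le> d \<Longrightarrow> m * t \<le> U (x + t) - U x" and "\<eta> > 0"
  shows "\<forall>\<^sub>F s in at_top. m - \<eta> \<le> Laplace_quotient e U x s"
proof -
  define r where "r t = U (x + t) - U x" for t
  have r: "continuous_on {0..e} r"
    unfolding r_def by (intro continuous_intros continuous_on_compose2[OF cont]) auto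
  have rd: "continuous_on {0..d} r"
    using continuous_on_subset[OF r] d by auto
  have moment: "integral {0..d} (\<lambda>t. exp (- (s * t)) * t)
      = 1 / s\<^sup>2 - exp (- (s * d)) * (d / s + 1 / s\<^sup>2)" if "s > 0" for s
  proof -
    have "((\<lambda>t. exp (- (s * t)) * t) has_integral
        (- exp (- (s * d)) * (d / s + 1 / s\<^sup>2)) - (- exp (- (s * 0)) * (0 / s + 1 / s\<^sup>2))) {0..d}"
      using that d
      by (intro fundamental_theorem_of_calculus)
        (auto intro!: derivative_eq_intros simp flip: has_real_derivative_iff_has_vector_derivative
          simp: field_simps power2_eq_square)
    then show ?thesis by (simp add: integral_unique)
  qed
  have exp_lim: "((\<lambda>s. exp (- (s * d)) * (s * d + 1)) \<longlongrightarrow> 0) at_top"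
  proof -
    have a: "filterlim (\<lambda>s. d * s) at_top at_top"
      using d by (intro filterlim_tendsto_pos_mult_at_top[OF tendsto_const _ filterlim_ident])
    have "((\<lambda>s. s ^ 1 / exp s + s ^ 0 / exp s) \<longlongrightarrow> (0::real) + 0) at_top"
      by (intro tendsto_add tendsto_power_div_exp_0)
    from filterlim_compose[OF this a] show ?thesis
      by (simp add: exp_minus field_simps)
  qed
  have "((\<lambda>s. m * (1 - exp (- (s * d)) * (s * d + 1))
          + (s\<^sup>2 * integral {0..e} (\<lambda>t. exp (- (s * t)) * r t)
            - s\<^sup>2 * integral {0..d} (\<lambda>t. exp (- (s * t)) * r t))) \<longlongrightarrow> m * (1 - 0) + 0) at_top"
    by (intro tendsto_intros exp_lim Laplace_tail_vanishes d r)
  then have "\<forall>\<^sub>F s in at_top. m - \<eta> < m * (1 - exp (- (s * d)) * (s * d + 1))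
          + (s\<^sup>2 * integral {0..e} (\<lambda>t. exp (- (s * t)) * r t)
            - s\<^sup>2 * integral {0..d} (\<lambda>t. exp (- (s * t)) * r t))"
    by (rule order_tendstoD) (use \<open>\<eta> > 0\<close> in simp)
  then show ?thesis
    using eventually_gt_at_top[of 0]
  proof eventually_elim
    case (elim s)
    have "m * integral {0..d} (\<lambda>t. exp (- (s * t)) * t)
        = integral {0..d} (\<lambda>t. m * (exp (- (s * t)) * t))"
      by simp
    also have "\<dots> \<le> integral {0..d} (\<lambda>t. exp (- (s * t)) * r t)"
    proof (rule integral_le)
      show "(\<lambda>t. m * (exp (- (s * t)) * t)) integrable_on {0..d}"
        by (intro integrable_continuous_real continuous_intros)
      show "(\<lambda>t. exp (- (s * t)) * r t) integrable_on {0..d}"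
        by (intro integrable_continuous_real continuous_intros rd)
      show "m * (exp (- (s * t)) * t) \<le> exp (- (s * t)) * r t" if "t \<in> {0..d}" for t
        using slope[of t] that by (simp add: r_def)
    qed
    finally have "s\<^sup>2 * (m * integral {0..d} (\<lambda>t. exp (- (s * t)) * t))
        \<le> s\<^sup>2 * integral {0..d} (\<lambda>t. exp (- (s * t)) * r t)"
      by (intro mult_left_mono) auto
    also have "s\<^sup>2 * (m * integral {0..d} (\<lambda>t. exp (- (s * t)) * t))
        = m * (1 - exp (- (s * d)) * (s * d + 1))"
    proof -
      have "s\<^sup>2 * (1 / s\<^sup>2 - E * (d / s + 1 / s\<^sup>2)) = 1 - E * (s * d + 1)" for E :: real
        using elim(2) by (simp add: right_diff_distrib distrib_left power2_eq_square)
      then show ?thesis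
        unfolding moment[OF elim(2)] by (metis mult.left_commute)
    qed
    finally show ?case
      using elim(1) by (simp add: Laplace_quotient_def r_def)
  qed
qed

lemma Laplace_quotient_add:
  assumes "continuous_on {x..x + e} U" "continuous_on {x..x + e} V"
  shows "Laplace_quotient e (\<lambda>z. U z + V z) x s = Laplace_quotient e U x s + Laplace_quotient e V x s"
proof -
  have int: "(\<lambda>t. exp (- (s * t)) * (W (x + t) - W x)) integrable_on {0..e}"
    if "continuous_on {x..x + e} W" for W :: "real \<Rightarrow> real"
    by (intro integrable_continuous_real continuous_intros continuous_on_compose2[OF that]) auto
  show ?thesis
    unfolding Laplace_quotient_def distrib_left[symmetric]
      integral_add[OF int[OF assms(1)] int[OF assms(2)], symmetric]
    by (simp add: algebra_simps)
qed

lemma Laplace_quotient_cmult: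
  "Laplace_quotient e (\<lambda>z. k * U z) x s = k * Laplace_quotient e U x s"
proof -
  have "integral {0..e} (\<lambda>t. exp (- (s * t)) * (k * U (x + t) - k * U x))
      = integral {0..e} (\<lambda>t. k * (exp (- (s * t)) * (U (x + t) - U x)))"
    by (simp add: algebra_simps)
  then show ?thesis
    unfolding Laplace_quotient_def by simp
qed

lemma lower_LD_right_add:
  assumes "continuous_on {x..x + e} U" "continuous_on {x..x + e} V"
    and "ereal a \<le> lower_LD_right e U x" "ereal b \<le> lower_LD_right e V x"
  shows "ereal (a + b) \<le> lower_LD_right e (\<lambda>z. U z + V z) x"
  unfolding ereal_le_lower_LD_right_iff
proof (intro allI impI)
  fix \<eta> :: real assume "\<eta> > 0"
  then have "\<forall>\<^sub>F s in at_top. a - \<eta> / 2 \<le> Laplace_quotient e U x s"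
    "\<forall>\<^sub>F s in at_top. b - \<eta> / 2 \<le> Laplace_quotient e V x s"
    using assms(3,4) by (simp_all add: ereal_le_lower_LD_right_iff)
  then show "\<forall>\<^sub>F s in at_top. a + b - \<eta> \<le> Laplace_quotient e (\<lambda>z. U z + V z) x s"
    by eventually_elim (simp add: Laplace_quotient_add[OF assms(1,2)])
qed

lemma lower_LD_right_cmult:
  assumes "ereal a \<le> lower_LD_right e U x" "0 \<le> k"
  shows "ereal (k * a) \<le> lower_LD_right e (\<lambda>z. k * U z) x"
  unfolding ereal_le_lower_LD_right_iff
proof (intro allI impI)
  fix \<eta> :: real assume \<eta>: "\<eta> > 0"
  define \<eta>' where "\<eta>' = \<eta> / (k + 1)"
  have \<eta>': "\<eta>' > 0" "k * \<eta>' \<le> \<eta>"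
    using \<eta> assms(2) by (auto simp: \<eta>'_def field_simps)
  have "\<forall>\<^sub>F s in at_top. a - \<eta>' \<le> Laplace_quotient e U x s"
    using assms(1) \<eta>'(1) by (simp add: ereal_le_lower_LD_right_iff)
  then show "\<forall>\<^sub>F s in at_top. k * a - \<eta> \<le> Laplace_quotient e (\<lambda>z. k * U z) x s"
  proof eventually_elim
    case (elim s)
    have "k * a - \<eta> \<le> k * (a - \<eta>')"
      using \<eta>'(2) by (simp add: algebra_simps)
    also have "\<dots> \<le> k * Laplace_quotient e U x s"
      using elim assms(2) by (rule mult_left_mono)
    finally show ?case
      by (simp add: Laplace_quotient_cmult)
  qed
qed

lemma lower_LD_right_ge_slope:
  assumes "continuous_on {x..x + e} U" "0 < d" "d \<le> e"
    and "\<And>t. 0 \<le> t \<Longrightarrow> t \<le> d \<Longrightarrow> m * t \<le> U (x + t) - U x"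
  shows "ereal m \<le> lower_LD_right e U x"
  unfolding ereal_le_lower_LD_right_iff by (intro allI impI Laplace_quotient_ge_slope[OF assms])

lemma lower_LD_right_ge_derivative:
  assumes cont: "continuous_on {x..x + e} U" and e: "0 < e"
    and D: "(U has_real_derivative m) (at x within {x..x + e})"
  shows "ereal m \<le> lower_LD_right e U x"
proof (rule ereal_le_epsilon2)
  fix \<eta> :: real assume \<eta>: "\<eta> > 0"
  from D have "((\<lambda>y. (U y - U x) / (y - x)) \<longlongrightarrow> m) (at x within {x..x + e})"
    by (simp add: has_field_derivative_iff)
  from order_tendstoD(1)[OF this, of "m - \<eta>"] \<eta>
  have "\<forall>\<^sub>F y in at x within {x..x + e}. m - \<eta> < (U y - U x) / (y - x)" by simp
  then obtain \<delta> where \<delta>: "\<delta> > 0"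
    "\<And>y. y \<in> {x..x + e} \<Longrightarrow> y \<noteq> x \<Longrightarrow> dist y x < \<delta> \<Longrightarrow> m - \<eta> < (U y - U x) / (y - x)"
    unfolding eventually_at by blast
  have "ereal (m - \<eta>) \<le> lower_LD_right e U x"
  proof (rule lower_LD_right_ge_slope[OF cont, of "min e (\<delta> / 2)"])
    show "0 < min e (\<delta> / 2)" "min e (\<delta> / 2) \<le> e" using \<delta> e by auto
    show "(m - \<eta>) * t \<le> U (x + t) - U x" if "0 \<le> t" "t \<le> min e (\<delta> / 2)" for t
      using \<delta>(2)[of "x + t"] that \<delta>(1) by (cases "t = 0") (auto simp: dist_real_def field_simps)
  qed
  then show "ereal m \<le> lower_LD_right e U x + ereal \<eta>"
    by (cases "lower_LD_right e U x") auto
qed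

text \<open>
  The tool for computing derivates of products: it suffices to find a multiple of \<open>U\<close> from which
  \<open>W\<close> differs by a function that is differentiable at the single point \<open>x\<close>.
\<close>

lemma lower_LD_right_perturb:
  assumes U: "continuous_on {x..x + e} U" and W: "continuous_on {x..x + e} W" and "0 < e" "0 \<le> k"
    and D: "((\<lambda>z. W z - k * U z) has_real_derivative d) (at x within {x..x + e})"
    and c: "ereal c \<le> lower_LD_right e U x"
  shows "ereal (k * c + d) \<le> lower_LD_right e W x"
proof -
  have kU: "continuous_on {x..x + e} (\<lambda>z. k * U z)"
    and r: "continuous_on {x..x + e} (\<lambda>z. W z - k * U z)"
    by (intro continuous_intros U W)+
  have "ereal (k * c + d) \<le> lower_LD_right e (\<lambda>z. k * U z + (W z - k * U z)) x"
    by (rule lower_LD_right_add[OF kU r lower_LD_right_cmult[OF c \<open>0 \<le> k\<close>]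
        lower_LD_right_ge_derivative[OF r \<open>0 < e\<close> D]])
  then show ?thesis by simp
qed

lemma continuous_on_reflect:
  fixes U :: "real \<Rightarrow> real"
  assumes "continuous_on {p..q} U"
  shows "continuous_on {- q..- p} (\<lambda>z. - U (- z))"
  by (intro continuous_intros continuous_on_compose2[OF assms]) auto

lemma lower_LD_add:
  assumes x: "x \<in> {p..q}" and U: "continuous_on {p..q} U" and V: "continuous_on {p..q} V"
    and "ereal a \<le> lower_LD p q U x" "ereal b \<le> lower_LD p q V x"
  shows "ereal (a + b) \<le> lower_LD p q (\<lambda>z. U z + V z) x"
proof -
  have r: "continuous_on {x..x + (q - x)} U" "continuous_on {x..x + (q - x)} V"
    using x continuous_on_subset[OF U] continuous_on_subset[OF V] by auto
  have l: "continuous_on {-x..-x + (x - p)} (\<lambda>z. - U (- z))"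
    "continuous_on {-x..-x + (x - p)} (\<lambda>z. - V (- z))"
    using x continuous_on_subset[OF continuous_on_reflect[OF U]]
      continuous_on_subset[OF continuous_on_reflect[OF V]] by auto
  have "- (U (- z) + V (- z)) = - U (- z) + - V (- z)" for z
    by simp
  then show ?thesis
    using assms(4,5) lower_LD_right_add[OF r, of a b] lower_LD_right_add[OF l, of a b]
    unfolding ereal_le_lower_LD_iff by simp
qed

lemma lower_LD_perturb:
  assumes x: "x \<in> {p..q}" and U: "continuous_on {p..q} U" and W: "continuous_on {p..q} W" and k: "0 \<le> k"
    and D: "((\<lambda>z. W z - k * U z) has_real_derivative d) (at x within {p..q})"
    and c: "ereal c \<le> lower_LD p q U x"
  shows "ereal (k * c + d) \<le> lower_LD p q W x"
  unfolding ereal_le_lower_LD_iff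
proof (intro conjI impI)
  assume "x < q"
  then show "ereal (k * c + d) \<le> lower_LD_right (q - x) W x"
  proof (intro lower_LD_right_perturb[where U = U])
    show "continuous_on {x..x + (q - x)} U" "continuous_on {x..x + (q - x)} W"
      using x by (auto intro: continuous_on_subset[OF U] continuous_on_subset[OF W])
    show "((\<lambda>z. W z - k * U z) has_real_derivative d) (at x within {x..x + (q - x)})"
      by (rule has_field_derivative_subset[OF D]) (use x in auto)
  qed (use x c k \<open>x < q\<close> in \<open>auto simp: ereal_le_lower_LD_iff\<close>)
next
  assume "p < x"
  have "((\<lambda>z. - ((\<lambda>z. W z - k * U z) \<circ> uminus) z) has_real_derivative - (d * - 1)) (at (- x) within {- q..- p})"
    using D by (intro DERIV_minus DERIV_image_chain) (auto intro!: derivative_eq_intros simp: image_uminus_atLeastAtMost)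
  then have D': "((\<lambda>z. - W (- z) - k * - U (- z)) has_real_derivative d) (at (- x) within {- q..- p})"
    by (simp add: o_def algebra_simps)
  show "ereal (k * c + d) \<le> lower_LD_right (x - p) (\<lambda>z. - W (- z)) (- x)"
  proof (intro lower_LD_right_perturb[where U = "\<lambda>z. - U (- z)"])
    show "continuous_on {- x..- x + (x - p)} (\<lambda>z. - U (- z))"
      "continuous_on {- x..- x + (x - p)} (\<lambda>z. - W (- z))"
      using x by (auto intro: continuous_on_subset[OF continuous_on_reflect[OF U]]
          continuous_on_subset[OF continuous_on_reflect[OF W]])
    show "((\<lambda>z. - W (- z) - k * - U (- z)) has_real_derivative d) (at (- x) within {- x..- x + (x - p)})"
      by (rule has_field_derivative_subset[OF D']) (use x in auto)
  qed (use x c k \<open>p < x\<close> in \<open>auto simp: ereal_le_lower_LD_iff\<close>)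
qed

section \<open>Major functions and the comparison principle\<close>

text \<open>
  One-sided derivates depend only on the function near the point, and shrinking the interval can
  only remove a side at an endpoint, which raises the minimum.
\<close>

lemma lower_LD_restrict:
  assumes U: "continuous_on {p..q} U" and I: "{p'..q'} \<subseteq> {p..q}" and x: "x \<in> {p'..q'}"
    and c: "ereal c \<le> lower_LD p q U x"
  shows "ereal c \<le> lower_LD p' q' U x"
proof -
  have *: "p \<le> p'" "q' \<le> q" "p' \<le> x" "x \<le> q'"
    using I x by auto
  have "lower_LD_right (q' - x) U x = lower_LD_right (q - x) U x" if "x < q'"
    using * that by (intro LD_delta_indep(1)) (auto intro: continuous_on_subset[OF U])
  moreover have "lower_LD_right (x - p') (\<lambda>z. - U (- z)) (- x) = lower_LD_right (x - p) (\<lambda>z. - U (- z)) (- x)"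
    if "p' < x"
    using * that
    by (intro LD_delta_indep(1)) (auto intro: continuous_on_subset[OF continuous_on_reflect[OF U]])
  ultimately show ?thesis
    using c * unfolding ereal_le_lower_LD_iff by auto
qed

lemma Laplace_major_iff:
  "Laplace_major f p q U \<longleftrightarrow>
     continuous_on {p..q} U \<and> (\<forall>x\<in>{p..q}. ereal (f x) \<le> lower_LD p q U x)"
proof -
  have "- \<infinity> < a" if "ereal r \<le> a" for r a
    using that by (cases a) auto
  then show ?thesis
    unfolding Laplace_major_def by blast
qed

lemma Laplace_minor_iff_major_uminus:
  "Laplace_minor f p q V \<longleftrightarrow> Laplace_major (\<lambda>x. - f x) p q (\<lambda>x. - V x)"
proof -
  have "continuous_on {p..q} V \<longleftrightarrow> continuous_on {p..q} (\<lambda>x. - V x)"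
    using continuous_on_minus[of "{p..q}" V] continuous_on_minus[of "{p..q}" "\<lambda>x. - V x"] by auto
  moreover have "- a \<le> ereal r \<and> - a < \<infinity> \<longleftrightarrow> ereal (- r) \<le> a \<and> - \<infinity> < a" for a r
    by (cases a) auto
  ultimately show ?thesis
    unfolding Laplace_minor_def Laplace_major_def upper_LD_uminus by simp
qed

text \<open>
  At a maximum point \<open>m < q\<close> of \<open>W\<close> all increments to the right are \<open>\<le> 0\<close>, and so are the averages
  that define the right derivate.  So the maximum over \<open>[p, q]\<close> can only be attained at \<open>q\<close>.
\<close>

lemma nondecreasing_if_lower_LD_right_pos:
  assumes "p \<le> q" and W: "continuous_on {p..q} W"
    and pos: "\<And>x. x \<in> {p..<q} \<Longrightarrow> 0 < lower_LD_right (q - x) W x"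
  shows "W p \<le> W q"
proof -
  obtain m where m: "m \<in> {p..q}" "\<And>y. y \<in> {p..q} \<Longrightarrow> W y \<le> W m"
    using continuous_attains_sup[OF compact_Icc _ W] assms(1) by (metis atLeastAtMost_iff empty_iff order_refl)
  have "m = q"
  proof (rule ccontr)
    assume "m \<noteq> q"
    then have mq: "m \<in> {p..<q}" using m by auto
    have "Laplace_quotient (q - m) W m s \<le> 0" for s
    proof -
      have "integral {0..q - m} (\<lambda>t. exp (- (s * t)) * (W (m + t) - W m)) \<le> integral {0..q - m} (\<lambda>t. 0)"
        using mq m(2) by (intro integral_le integrable_continuous_real continuous_intros
            continuous_on_compose2[OF W]) (auto intro!: mult_nonneg_nonpos)
      then show ?thesis
        by (simp add: Laplace_quotient_def mult_nonneg_nonpos)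
    qed
    then have "lower_LD_right (q - m) W m \<le> 0"
      unfolding lower_LD_right_def Laplace_quotient_def[symmetric]
      by (intro order.trans[OF Liminf_le_Limsup Limsup_bounded]) auto
    then show False using pos[OF mq] by simp
  qed
  then show ?thesis using m(2)[of p] assms(1) by simp
qed

text \<open>
  The comparison principle behind the uniqueness of the integral: the lower derivate of \<open>U - V\<close>
  is \<open>\<ge> 0\<close>, and an added term of small slope \<open>k\<close> makes it strictly positive.  Right derivates
  suffice, which matters later for functions that are controlled only to the right of each point.
\<close>

lemma increment_le_if_lower_LD_right:
  assumes "p \<le> q" and U: "continuous_on {p..q} U" and V: "continuous_on {p..q} V"
    and U': "\<And>x. x \<in> {p..<q} \<Longrightarrow> ereal (f x) \<le> lower_LD_right (q - x) U x"
    and V': "\<And>x. x \<in> {p..<q} \<Longrightarrow> ereal (- f x) \<le> lower_LD_right (q - x) (\<lambda>x. - V x) x"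
  shows "V q - V p \<le> U q - U p"
proof (rule field_le_epsilon)
  fix e :: real assume "e > 0"
  define k where "k = e / (q - p + 1)"
  have k: "k > 0" "k * (q - p) \<le> e"
    using \<open>e > 0\<close> assms(1) by (auto simp: k_def field_simps)
  define W where "W x = (U x + - V x) + k * x" for x
  have "W p \<le> W q"
  proof (rule nondecreasing_if_lower_LD_right_pos[OF assms(1)])
    show "continuous_on {p..q} W"
      unfolding W_def by (intro continuous_intros U V)
    fix x assume x: "x \<in> {p..<q}"
    have c: "continuous_on {x..x + (q - x)} U" "continuous_on {x..x + (q - x)} (\<lambda>x. - V x)"
      "continuous_on {x..x + (q - x)} (\<lambda>x. U x + - V x)" "continuous_on {x..x + (q - x)} (\<lambda>x. k * x)"
      using x by (auto intro!: continuous_intros intro: continuous_on_subset[OF U] continuous_on_subset[OF V])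
    have "ereal k \<le> lower_LD_right (q - x) (\<lambda>x. k * x) x"
      using x by (intro lower_LD_right_ge_slope[OF c(4), of "q - x"]) (auto simp: algebra_simps)
    from lower_LD_right_add[OF c(3,4) lower_LD_right_add[OF c(1,2) U'[OF x] V'[OF x]] this]
    have "ereal k \<le> lower_LD_right (q - x) W x"
      by (simp add: W_def[abs_def])
    moreover have "0 < ereal k" using k by simp
    ultimately show "0 < lower_LD_right (q - x) W x" by (rule less_le_trans[rotated])
  qed
  then have "V q - V p \<le> U q - U p + k * (q - p)"
    by (simp add: W_def algebra_simps)
  then show "V q - V p \<le> U q - U p + e"
    using k by linarith
qed

lemma Laplace_minor_increment_le_major:
  assumes "p \<le> q" "Laplace_major f p q U" "Laplace_minor f p q V"
  shows "V q - V p \<le> U q - U p"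
proof (rule increment_le_if_lower_LD_right[OF assms(1)])
  show "continuous_on {p..q} U" "continuous_on {p..q} V"
    using assms by (auto simp: Laplace_major_def Laplace_minor_def)
  show "ereal (f x) \<le> lower_LD_right (q - x) U x" if "x \<in> {p..<q}" for x
    using that assms(2) by (auto simp: Laplace_major_iff ereal_le_lower_LD_iff)
  show "ereal (- f x) \<le> lower_LD_right (q - x) (\<lambda>x. - V x) x" if "x \<in> {p..<q}" for x
    using that assms(3) by (auto simp: Laplace_minor_iff_major_uminus Laplace_major_iff ereal_le_lower_LD_iff)
qed

section \<open>Basic properties of the Laplace integral\<close>

text \<open>
  By the comparison principle the infimum is never smaller than the supremum, so approximating
  \<open>I\<close> from both sides forces both to equal \<open>I\<close>.
\<close>

lemma has_Laplace_integral_iff: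
  assumes "p \<le> q"
  shows "has_Laplace_integral f p q I \<longleftrightarrow>
    (\<forall>e>0. (\<exists>U. Laplace_major f p q U \<and> U q - U p < I + e) \<and>
           (\<exists>V. Laplace_minor f p q V \<and> I - e < V q - V p))"
proof
  assume I: "has_Laplace_integral f p q I"
  show "\<forall>e>0. (\<exists>U. Laplace_major f p q U \<and> U q - U p < I + e) \<and>
           (\<exists>V. Laplace_minor f p q V \<and> I - e < V q - V p)"
  proof (intro allI impI conjI)
    fix e :: real assume "e > 0"
    then have "(INF U\<in>{U. Laplace_major f p q U}. ereal (U q - U p)) < ereal (I + e)"
      "ereal (I - e) < (SUP V\<in>{V. Laplace_minor f p q V}. ereal (V q - V p))"
      using I by (auto simp: has_Laplace_integral_def)
    then show "\<exists>U. Laplace_major f p q U \<and> U q - U p < I + e"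
      "\<exists>V. Laplace_minor f p q V \<and> I - e < V q - V p"
      by (auto simp: INF_less_iff less_SUP_iff)
  qed
next
  assume *: "\<forall>e>0. (\<exists>U. Laplace_major f p q U \<and> U q - U p < I + e) \<and>
           (\<exists>V. Laplace_minor f p q V \<and> I - e < V q - V p)"
  have major: "I \<le> U q - U p" if "Laplace_major f p q U" for U
  proof (rule field_le_epsilon)
    fix e :: real assume "e > 0"
    then obtain V where "Laplace_minor f p q V" "I - e < V q - V p" using * by blast
    then show "I \<le> U q - U p + e"
      using Laplace_minor_increment_le_major[OF assms that] by fastforce
  qed
  have minor: "V q - V p \<le> I" if "Laplace_minor f p q V" for V
  proof (rule field_le_epsilon)
    fix e :: real assume "e > 0"
    then obtain U where "Laplace_major f p q U" "U q - U p < I + e" using * by blast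
    then show "V q - V p \<le> I + e"
      using Laplace_minor_increment_le_major[OF assms _ that] by fastforce
  qed
  have "(INF U\<in>{U. Laplace_major f p q U}. ereal (U q - U p)) = ereal I"
  proof (rule antisym)
    show "(INF U\<in>{U. Laplace_major f p q U}. ereal (U q - U p)) \<le> ereal I"
    proof (rule ereal_le_epsilon2)
      fix e :: real assume "e > 0"
      then obtain U where U: "Laplace_major f p q U" "U q - U p < I + e" using * by blast
      then have "(INF U\<in>{U. Laplace_major f p q U}. ereal (U q - U p)) \<le> ereal (U q - U p)"
        by (intro INF_lower) auto
      also have "\<dots> \<le> ereal I + ereal e" using U by simp
      finally show "(INF U\<in>{U. Laplace_major f p q U}. ereal (U q - U p)) \<le> ereal I + ereal e" .
    qed
  qed (auto intro!: INF_greatest major)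
  moreover have "(SUP V\<in>{V. Laplace_minor f p q V}. ereal (V q - V p)) = ereal I"
  proof (rule antisym)
    show "ereal I \<le> (SUP V\<in>{V. Laplace_minor f p q V}. ereal (V q - V p))"
    proof (rule ereal_le_epsilon2)
      fix e :: real assume "e > 0"
      then obtain V where V: "Laplace_minor f p q V" "I - e < V q - V p" using * by blast
      have "ereal I \<le> ereal (V q - V p) + ereal e" using V by simp
      also have "\<dots> \<le> (SUP V\<in>{V. Laplace_minor f p q V}. ereal (V q - V p)) + ereal e"
        using V by (intro add_right_mono SUP_upper) auto
      finally show "ereal I \<le> (SUP V\<in>{V. Laplace_minor f p q V}. ereal (V q - V p)) + ereal e" .
    qed
  qed (auto intro!: SUP_least minor)
  moreover have "\<exists>U. Laplace_major f p q U" "\<exists>V. Laplace_minor f p q V"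
    using *[rule_format, of 1] by auto
  ultimately show "has_Laplace_integral f p q I"
    by (simp add: has_Laplace_integral_def)
qed

lemma has_Laplace_integral_major:
  assumes "has_Laplace_integral f p q I" "Laplace_major f p q U"
  shows "I \<le> U q - U p"
proof -
  have "ereal I = (INF U\<in>{U. Laplace_major f p q U}. ereal (U q - U p))"
    using assms(1) by (simp add: has_Laplace_integral_def)
  also have "\<dots> \<le> ereal (U q - U p)"
    using assms(2) by (intro INF_lower) auto
  finally show ?thesis by simp
qed

lemma has_Laplace_integral_minor:
  assumes "has_Laplace_integral f p q I" "Laplace_minor f p q V"
  shows "V q - V p \<le> I"
proof -
  have "ereal (V q - V p) \<le> (SUP V\<in>{V. Laplace_minor f p q V}. ereal (V q - V p))"
    using assms(2) by (intro SUP_upper) auto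
  also have "\<dots> = ereal I"
    using assms(1) by (simp add: has_Laplace_integral_def)
  finally show ?thesis by simp
qed

lemma Laplace_integral_unique: "has_Laplace_integral f p q I \<Longrightarrow> Laplace_integral f p q = I"
  unfolding Laplace_integral_def by (rule the_equality) (auto simp: has_Laplace_integral_def)

lemma Laplace_integrable_integral:
  "Laplace_integrable f p q \<Longrightarrow> has_Laplace_integral f p q (Laplace_integral f p q)"
  unfolding Laplace_integrable_def using Laplace_integral_unique by blast

lemma Laplace_integrable_iff:
  assumes "p \<le> q"
  shows "Laplace_integrable f p q \<longleftrightarrow>
    (\<forall>e>0. \<exists>U V. Laplace_major f p q U \<and> Laplace_minor f p q V \<and> (U q - U p) - (V q - V p) < e)"
    (is "_ \<longleftrightarrow> ?R")
proof
  assume "Laplace_integrable f p q"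
  then obtain I where I: "has_Laplace_integral f p q I" by (auto simp: Laplace_integrable_def)
  show ?R
  proof (intro allI impI)
    fix e :: real assume "e > 0"
    then have "e / 2 > 0" by simp
    then obtain U V where "Laplace_major f p q U" "U q - U p < I + e / 2"
      "Laplace_minor f p q V" "I - e / 2 < V q - V p"
      using I unfolding has_Laplace_integral_iff[OF assms] by blast
    then show "\<exists>U V. Laplace_major f p q U \<and> Laplace_minor f p q V \<and> (U q - U p) - (V q - V p) < e"
      by (intro exI[of _ U] exI[of _ V]) auto
  qed
next
  assume R: ?R
  define S where "S = {U q - U p | U. Laplace_major f p q U}"
  from R[rule_format, of 1] obtain U0 V0 where UV0: "Laplace_major f p q U0" "Laplace_minor f p q V0"
    by auto
  have S: "S \<noteq> {}" "bdd_below S"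
    using UV0 Laplace_minor_increment_le_major[OF assms]
    by (auto simp: S_def intro!: bdd_belowI[of _ "V0 q - V0 p"])
  have "has_Laplace_integral f p q (Inf S)"
    unfolding has_Laplace_integral_iff[OF assms]
  proof (intro allI impI conjI)
    fix e :: real assume "e > 0"
    then obtain U V where UV: "Laplace_major f p q U" "Laplace_minor f p q V"
        "(U q - U p) - (V q - V p) < e"
      using R by blast
    have "V q - V p \<le> Inf S"
      by (rule cInf_greatest[OF S(1)]) (auto simp: S_def intro!: Laplace_minor_increment_le_major[OF assms _ UV(2)])
    moreover have "Inf S \<le> U q - U p"
      by (rule cInf_lower[OF _ S(2)]) (use UV in \<open>auto simp: S_def\<close>)
    ultimately have "U q - U p < Inf S + e" "Inf S - e < V q - V p" using UV by auto
    with UV show "\<exists>U. Laplace_major f p q U \<and> U q - U p < Inf S + e"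
      "\<exists>V. Laplace_minor f p q V \<and> Inf S - e < V q - V p" by auto
  qed
  then show "Laplace_integrable f p q" by (auto simp: Laplace_integrable_def)
qed

lemma Laplace_major_restrict:
  assumes "Laplace_major f p q U" "{p'..q'} \<subseteq> {p..q}"
  shows "Laplace_major f p' q' U"
  using assms lower_LD_restrict[OF _ assms(2)] continuous_on_subset[OF _ assms(2)]
  unfolding Laplace_major_iff by blast

lemma Laplace_minor_restrict:
  assumes "Laplace_minor f p q V" "{p'..q'} \<subseteq> {p..q}"
  shows "Laplace_minor f p' q' V"
  using assms Laplace_major_restrict unfolding Laplace_minor_iff_major_uminus by blast

text \<open>
  The difference between a major and a minor function is nondecreasing, so its increment over a
  subinterval is no larger than that over the whole interval.
\<close>

lemma Laplace_integrable_restrict: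
  assumes f: "Laplace_integrable f p q" and I: "p \<le> p'" "p' \<le> q'" "q' \<le> q"
  shows "Laplace_integrable f p' q'"
proof -
  have pq: "p \<le> q" and sub: "{p'..q'} \<subseteq> {p..q}" "{p..p'} \<subseteq> {p..q}" "{q'..q} \<subseteq> {p..q}"
    using I by auto
  show ?thesis
    unfolding Laplace_integrable_iff[OF I(2)]
  proof (intro allI impI)
    fix e :: real assume "e > 0"
    then obtain U V where U: "Laplace_major f p q U" and V: "Laplace_minor f p q V"
      and e: "(U q - U p) - (V q - V p) < e"
      using f Laplace_integrable_iff[OF pq] by blast
    have "V p' - V p \<le> U p' - U p"
      by (rule Laplace_minor_increment_le_major[OF I(1) Laplace_major_restrict[OF U sub(2)]
            Laplace_minor_restrict[OF V sub(2)]])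
    moreover have "V q - V q' \<le> U q - U q'"
      by (rule Laplace_minor_increment_le_major[OF I(3) Laplace_major_restrict[OF U sub(3)]
            Laplace_minor_restrict[OF V sub(3)]])
    ultimately show "\<exists>U V. Laplace_major f p' q' U \<and> Laplace_minor f p' q' V \<and>
        (U q' - U p') - (V q' - V p') < e"
      using e Laplace_major_restrict[OF U sub(1)] Laplace_minor_restrict[OF V sub(1)]
      by (intro exI[of _ U] exI[of _ V]) auto
  qed
qed

text \<open>
  No gluing of major functions is involved: a major function on \<open>[p, q]\<close> restricts to major
  functions on both parts, so the sum of the two integrals is at most each of its increments; minor
  functions give the opposite inequality.
\<close>

lemma Laplace_integral_combine:
  assumes f: "Laplace_integrable f p q" and m: "p \<le> m" "m \<le> q"
  shows "Laplace_integral f p q = Laplace_integral f p m + Laplace_integral f m q"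
proof -
  have pq: "p \<le> q" and sub: "{p..m} \<subseteq> {p..q}" "{m..q} \<subseteq> {p..q}"
    using m by auto
  note I = Laplace_integrable_integral[OF f]
  note I1 = Laplace_integrable_integral[OF Laplace_integrable_restrict[OF f order_refl m]]
  note I2 = Laplace_integrable_integral[OF Laplace_integrable_restrict[OF f m order_refl]]
  let ?s = "Laplace_integral f p m + Laplace_integral f m q"
  have "\<bar>Laplace_integral f p q - ?s\<bar> \<le> e" if e: "e > 0" for e
  proof -
    from I[unfolded has_Laplace_integral_iff[OF pq], rule_format, OF e]
    obtain U V where U: "Laplace_major f p q U" "U q - U p < Laplace_integral f p q + e"
      and V: "Laplace_minor f p q V" "Laplace_integral f p q - e < V q - V p"
      by blast
    have "?s \<le> U q - U p"
      using has_Laplace_integral_major[OF I1 Laplace_major_restrict[OF U(1) sub(1)]]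
        has_Laplace_integral_major[OF I2 Laplace_major_restrict[OF U(1) sub(2)]] by linarith
    moreover have "V q - V p \<le> ?s"
      using has_Laplace_integral_minor[OF I1 Laplace_minor_restrict[OF V(1) sub(1)]]
        has_Laplace_integral_minor[OF I2 Laplace_minor_restrict[OF V(1) sub(2)]] by linarith
    ultimately show ?thesis using U V by linarith
  qed
  then have "\<bar>Laplace_integral f p q - ?s\<bar> \<le> 0"
    by (rule field_le_epsilon) simp
  then show ?thesis by simp
qed

lemma Laplace_major_add:
  assumes "Laplace_major f p q U" "Laplace_major g p q V"
  shows "Laplace_major (\<lambda>x. f x + g x) p q (\<lambda>x. U x + V x)"
  using assms lower_LD_add[of _ p q U V] unfolding Laplace_major_iff
  by (auto intro!: continuous_intros)

lemma has_Laplace_integral_uminus: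
  assumes "p \<le> q" and I: "has_Laplace_integral f p q I"
  shows "has_Laplace_integral (\<lambda>x. - f x) p q (- I)"
  unfolding has_Laplace_integral_iff[OF assms(1)]
proof (intro allI impI conjI)
  fix e :: real assume "e > 0"
  then obtain U V where U: "Laplace_major f p q U" "U q - U p < I + e"
    and V: "Laplace_minor f p q V" "I - e < V q - V p"
    using I unfolding has_Laplace_integral_iff[OF assms(1)] by blast
  show "\<exists>U. Laplace_major (\<lambda>x. - f x) p q U \<and> U q - U p < - I + e"
    using V by (intro exI[of _ "\<lambda>x. - V x"]) (auto simp: Laplace_minor_iff_major_uminus)
  show "\<exists>V. Laplace_minor (\<lambda>x. - f x) p q V \<and> - I - e < V q - V p"
    using U by (intro exI[of _ "\<lambda>x. - U x"]) (auto simp: Laplace_minor_iff_major_uminus)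
qed

lemma Laplace_integrable_uminus:
  "p \<le> q \<Longrightarrow> Laplace_integrable f p q \<Longrightarrow> Laplace_integrable (\<lambda>x. - f x) p q"
  using has_Laplace_integral_uminus unfolding Laplace_integrable_def by blast

lemma Laplace_integral_uminus:
  "p \<le> q \<Longrightarrow> Laplace_integrable f p q \<Longrightarrow> Laplace_integral (\<lambda>x. - f x) p q = - Laplace_integral f p q"
  by (intro Laplace_integral_unique has_Laplace_integral_uminus Laplace_integrable_integral)

lemma Laplace_integrable_add:
  assumes "p \<le> q" and f: "Laplace_integrable f p q" and g: "Laplace_integrable g p q"
  shows "Laplace_integrable (\<lambda>x. f x + g x) p q"
  unfolding Laplace_integrable_iff[OF assms(1)]
proof (intro allI impI)
  fix e :: real assume "e > 0"
  then have e2: "e / 2 > 0" by simp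
  from f e2 obtain U V where U: "Laplace_major f p q U" and V: "Laplace_minor f p q V"
    and 1: "(U q - U p) - (V q - V p) < e / 2"
    unfolding Laplace_integrable_iff[OF assms(1)] by blast
  from g e2 obtain U' V' where U': "Laplace_major g p q U'" and V': "Laplace_minor g p q V'"
    and 2: "(U' q - U' p) - (V' q - V' p) < e / 2"
    unfolding Laplace_integrable_iff[OF assms(1)] by blast
  have "Laplace_minor (\<lambda>x. f x + g x) p q (\<lambda>x. V x + V' x)"
    using Laplace_major_add[OF V[unfolded Laplace_minor_iff_major_uminus]
        V'[unfolded Laplace_minor_iff_major_uminus]]
    by (simp add: Laplace_minor_iff_major_uminus)
  then show "\<exists>U V. Laplace_major (\<lambda>x. f x + g x) p q U \<and> Laplace_minor (\<lambda>x. f x + g x) p q V \<and>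
      (U q - U p) - (V q - V p) < e"
    using 1 2 Laplace_major_add[OF U U']
    by (intro exI[of _ "\<lambda>x. U x + U' x"] exI[of _ "\<lambda>x. V x + V' x"]) auto
qed

lemma has_Laplace_integral_reflect:
  assumes "p \<le> q" and I: "has_Laplace_integral f p q I"
  shows "has_Laplace_integral (\<lambda>x. f (- x)) (- q) (- p) I"
proof -
  have major: "Laplace_major (\<lambda>x. g (- x)) (- q) (- p) (\<lambda>x. - U (- x))" if "Laplace_major g p q U" for g U
    unfolding Laplace_major_iff
  proof (intro conjI ballI)
    show "continuous_on {- q..- p} (\<lambda>x. - U (- x))"
      using that by (intro continuous_on_reflect) (simp add: Laplace_major_iff)
    fix x assume "x \<in> {- q..- p}"
    then have "- x \<in> {p..q}" by auto
    then have "ereal (g (- x)) \<le> lower_LD p q U (- x)"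
      using that unfolding Laplace_major_iff by blast
    also have "\<dots> = lower_LD (- q) (- p) (\<lambda>x. - U (- x)) x"
      using lower_LD_reflect[of p q U "- x"] by (simp only: minus_minus)
    finally show "ereal (g (- x)) \<le> lower_LD (- q) (- p) (\<lambda>x. - U (- x)) x" .
  qed
  have minor: "Laplace_minor (\<lambda>x. f (- x)) (- q) (- p) (\<lambda>x. - V (- x))" if "Laplace_minor f p q V" for V
    using major[OF that[unfolded Laplace_minor_iff_major_uminus]]
    by (simp add: Laplace_minor_iff_major_uminus)
  have le: "- q \<le> - p" using assms(1) by simp
  show ?thesis
    unfolding has_Laplace_integral_iff[OF le]
  proof (intro allI impI conjI)
    fix e :: real assume "e > 0"
    then obtain U V where U: "Laplace_major f p q U" "U q - U p < I + e"
      and V: "Laplace_minor f p q V" "I - e < V q - V p"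
      using I unfolding has_Laplace_integral_iff[OF assms(1)] by blast
    show "\<exists>U. Laplace_major (\<lambda>x. f (- x)) (- q) (- p) U \<and> U (- p) - U (- q) < I + e"
      using U by (intro exI[of _ "\<lambda>x. - U (- x)"]) (auto intro: major)
    show "\<exists>V. Laplace_minor (\<lambda>x. f (- x)) (- q) (- p) V \<and> I - e < V (- p) - V (- q)"
      using V by (intro exI[of _ "\<lambda>x. - V (- x)"]) (auto intro: minor)
  qed
qed

section \<open>Products with continuously differentiable functions\<close>

lemma Laplace_major_shift:
  assumes "Laplace_major f p q U"
  shows "Laplace_major f p q (\<lambda>x. U x + c)"
proof -
  have "lower_LD p q (\<lambda>x. U x + c) x = lower_LD p q U x" for x
    by (simp add: lower_LD_def lower_LD_left_def lower_LD_right_def)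
  then show ?thesis
    using assms by (auto simp: Laplace_major_iff intro!: continuous_intros)
qed

text \<open>
  The candidate comes from integration by parts: \<open>G dU = d(U G) - U dG\<close>.  At a fixed \<open>x\<close>,
  subtracting \<open>G x * U z\<close> from it leaves \<open>U z * (G z - G x)\<close> minus the integral, and both have
  derivative \<open>U x * G' x\<close> at \<open>x\<close> although \<open>U\<close> is merely continuous.  The candidate thus has
  the derivates of \<open>G x * U\<close> at \<open>x\<close>; nonnegativity of \<open>G\<close> preserves the inequality.
\<close>

lemma Laplace_major_mult:
  assumes U: "Laplace_major f p q U"
    and G: "\<And>x. x \<in> {p..q} \<Longrightarrow> (G has_real_derivative G' x) (at x within {p..q})"
    and G': "continuous_on {p..q} G'" and nonneg: "\<And>x. x \<in> {p..q} \<Longrightarrow> 0 \<le> G x"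
  shows "Laplace_major (\<lambda>x. f x * G x) p q (\<lambda>x. U x * G x - integral {p..x} (\<lambda>t. U t * G' t))"
  unfolding Laplace_major_iff
proof (intro conjI ballI)
  let ?H = "\<lambda>x. integral {p..x} (\<lambda>t. U t * G' t)"
  have Uc: "continuous_on {p..q} U"
    using U by (simp add: Laplace_major_iff)
  have UG': "continuous_on {p..q} (\<lambda>t. U t * G' t)"
    by (intro continuous_intros Uc G')
  have H: "(?H has_real_derivative U x * G' x) (at x within {p..q})" if "x \<in> {p..q}" for x
    by (rule integral_has_real_derivative[OF UG' that])
  show cont: "continuous_on {p..q} (\<lambda>x. U x * G x - ?H x)"
    by (intro continuous_intros Uc DERIV_continuous_on[OF G] DERIV_continuous_on[OF H])
  fix x assume x: "x \<in> {p..q}"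
  have "((\<lambda>z. U z * (G z - G x)) has_real_derivative U x * G' x) (at x within {p..q})"
  proof -
    have "((\<lambda>z. U z * ((G z - G x) / (z - x))) \<longlongrightarrow> U x * G' x) (at x within {p..q})"
      using Uc G[OF x] x by (intro tendsto_mult) (auto simp: continuous_on_def has_field_derivative_iff)
    then show ?thesis
      by (simp add: has_field_derivative_iff)
  qed
  from DERIV_diff[OF this H[OF x]]
  have D: "((\<lambda>z. (U z * G z - ?H z) - G x * U z) has_real_derivative 0) (at x within {p..q})"
    by (simp add: algebra_simps)
  have "ereal (G x * f x + 0) \<le> lower_LD p q (\<lambda>x. U x * G x - ?H x) x"
    using U x by (intro lower_LD_perturb[OF x Uc cont nonneg[OF x] D]) (simp add: Laplace_major_iff)
  then show "ereal (f x * G x) \<le> lower_LD p q (\<lambda>x. U x * G x - ?H x) x"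
    by (simp add: mult.commute)
qed

text \<open>
  If \<open>U\<close> and \<open>V\<close> vanish at \<open>p\<close>, then \<open>D = U - V\<close> satisfies \<open>0 \<le> D \<le> D q\<close>, where \<open>D q\<close> is as
  small as desired.  The gap between the major and the minor function obtained for the product is
  \<open>D q * G q - \<integral> D G'\<close>, hence at most a constant times \<open>D q\<close>.
\<close>

lemma Laplace_integrable_mult:
  assumes pq: "p \<le> q" and f: "Laplace_integrable f p q"
    and G: "\<And>x. x \<in> {p..q} \<Longrightarrow> (G has_real_derivative G' x) (at x within {p..q})"
    and G': "continuous_on {p..q} G'" and nonneg: "\<And>x. x \<in> {p..q} \<Longrightarrow> 0 \<le> G x"
  shows "Laplace_integrable (\<lambda>x. f x * G x) p q"
  unfolding Laplace_integrable_iff[OF pq]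
proof (intro allI impI)
  fix e :: real assume e: "e > 0"
  have "\<exists>K\<ge>0. \<forall>x\<in>{p..q}. \<bar>F x\<bar> \<le> K" if F: "continuous_on {p..q} F" for F :: "real \<Rightarrow> real"
    using compact_imp_bounded[OF compact_continuous_image[OF F compact_Icc]]
    unfolding bounded_pos by (auto intro: less_imp_le)
  then obtain K K' where K: "K \<ge> 0" "\<And>x. x \<in> {p..q} \<Longrightarrow> \<bar>G x\<bar> \<le> K"
    and K': "K' \<ge> 0" "\<And>x. x \<in> {p..q} \<Longrightarrow> \<bar>G' x\<bar> \<le> K'"
    using DERIV_continuous_on[OF G] G' by metis
  define c where "c = K + K' * (q - p) + 1"
  have c: "c > 0"
    using K(1) K'(1) pq by (simp add: c_def add_nonneg_pos)
  then have "e / c > 0" using e by simp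
  then obtain U0 V0 where U0: "Laplace_major f p q U0" and V0: "Laplace_minor f p q V0"
    and UV0: "(U0 q - U0 p) - (V0 q - V0 p) < e / c"
    using f unfolding Laplace_integrable_iff[OF pq] by blast
  define U where "U x = U0 x - U0 p" for x
  define V where "V x = V0 x - V0 p" for x
  have U: "Laplace_major f p q U"
    using Laplace_major_shift[OF U0, of "- U0 p"] by (simp add: U_def[abs_def])
  have V: "Laplace_minor f p q V"
    using Laplace_major_shift[OF V0[unfolded Laplace_minor_iff_major_uminus], of "V0 p"]
    by (simp add: Laplace_minor_iff_major_uminus V_def[abs_def] algebra_simps)
  have Uc: "continuous_on {p..q} U" and Vc: "continuous_on {p..q} V"
    using U V by (auto simp: Laplace_major_def Laplace_minor_def)
  define D where "D x = U x - V x" for x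
  have D: "0 \<le> D x" "D x \<le> D q" if x: "x \<in> {p..q}" for x
  proof -
    have sub: "{p..x} \<subseteq> {p..q}" "{x..q} \<subseteq> {p..q}" and le: "p \<le> x" "x \<le> q"
      using x by auto
    show "0 \<le> D x"
      using Laplace_minor_increment_le_major[OF le(1) Laplace_major_restrict[OF U sub(1)]
          Laplace_minor_restrict[OF V sub(1)]]
      by (simp add: D_def U_def V_def)
    show "D x \<le> D q"
      using Laplace_minor_increment_le_major[OF le(2) Laplace_major_restrict[OF U sub(2)]
          Laplace_minor_restrict[OF V sub(2)]]
      by (simp add: D_def)
  qed
  have Dq: "D q < e / c"
    using UV0 by (simp add: D_def U_def V_def)
  let ?W = "\<lambda>U x. U x * G x - integral {p..x} (\<lambda>t. U t * G' t)"
  have major: "Laplace_major (\<lambda>x. f x * G x) p q (?W U)"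
    by (rule Laplace_major_mult[OF U G G' nonneg])
  have minor: "Laplace_minor (\<lambda>x. f x * G x) p q (?W V)"
    using Laplace_major_mult[OF V[unfolded Laplace_minor_iff_major_uminus] G G' nonneg]
    by (simp add: Laplace_minor_iff_major_uminus)
  have int: "(\<lambda>t. U t * G' t) integrable_on {p..q}" "(\<lambda>t. V t * G' t) integrable_on {p..q}"
    by (intro integrable_continuous_real continuous_intros Uc Vc G')+
  have "(?W U q - ?W U p) - (?W V q - ?W V p) = D q * G q - integral {p..q} (\<lambda>t. D t * G' t)"
    using integral_diff[OF int] by (simp add: D_def U_def V_def left_diff_distrib)
  also have "\<dots> \<le> D q * K + D q * K' * (q - p)"
  proof -
    have "D q * G q \<le> D q * K"
      using D[of q] K(2)[of q] pq by (intro mult_left_mono) auto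
    moreover have "norm (integral {p..q} (\<lambda>t. D t * G' t)) \<le> D q * K' * (q - p)"
    proof (rule integral_bound[OF pq])
      show "continuous_on {p..q} (\<lambda>t. D t * G' t)"
        unfolding D_def by (intro continuous_intros Uc Vc G')
      show "norm (D t * G' t) \<le> D q * K'" if "t \<in> {p..q}" for t
        using D[OF that] K'(2)[OF that] by (auto simp: abs_mult intro!: mult_mono)
    qed
    ultimately show ?thesis by simp
  qed
  also have "\<dots> \<le> D q * c"
    using D(1)[of q] pq by (simp add: c_def algebra_simps)
  also have "\<dots> < e"
    using Dq c by (simp add: field_simps)
  finally show "\<exists>U V. Laplace_major (\<lambda>x. f x * G x) p q U \<and> Laplace_minor (\<lambda>x. f x * G x) p q V \<and>
      (U q - U p) - (V q - V p) < e"
    using major minor by blast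
qed

text \<open>
  The factor \<open>1 + sin\<close> is nonnegative, and \<open>f sin = f (1 + sin) - f\<close>.
\<close>

lemma Laplace_integrable_mult_sin:
  assumes "p \<le> q" "Laplace_integrable f p q"
  shows "Laplace_integrable (\<lambda>x. f x * sin (\<omega> * x + \<theta>)) p q"
proof -
  have "Laplace_integrable (\<lambda>x. f x * (1 + sin (\<omega> * x + \<theta>))) p q"
  proof (rule Laplace_integrable_mult[OF assms])
    show "((\<lambda>x. 1 + sin (\<omega> * x + \<theta>)) has_real_derivative \<omega> * cos (\<omega> * x + \<theta>)) (at x within {p..q})" for x
      by (auto intro!: derivative_eq_intros)
    show "0 \<le> 1 + sin (\<omega> * x + \<theta>)" for x
      using sin_ge_minus_one[of "\<omega> * x + \<theta>"] by linarith
  qed (intro continuous_intros)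
  from Laplace_integrable_add[OF assms(1) this Laplace_integrable_uminus[OF assms]] show ?thesis
    by (simp add: algebra_simps)
qed

section \<open>Comparison with the Lebesgue integral\<close>

text \<open>
  An elementary form of the Vitali-Caratheodory theorem.  Cut \<open>g\<close> into the superlevel sets
  \<open>E n = {g \<ge> (n + 1) \<epsilon>}\<close>; the sum of \<open>\<epsilon>\<close> times their indicators lies below \<open>g\<close>, and within \<open>\<epsilon>\<close> of it.
  Replace each \<open>E n\<close> by a slightly larger open set \<open>G n\<close> and put
  \<open>U x = \<epsilon> x + (\<Sum>n. \<epsilon> |G n \<inter> [p, x]|)\<close>.  If \<open>N \<epsilon> \<le> g x \<le> (N + 1) \<epsilon>\<close>, then \<open>x\<close> lies in the open sets
  \<open>G 0, \<dots>, G (N - 1)\<close>, so each of these \<open>N\<close> summands grows with slope \<open>\<epsilon>\<close> near \<open>x\<close>; together with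
  the linear term the slope is at least \<open>(N + 1) \<epsilon> \<ge> g x\<close>.
\<close>

lemma layer_cake_upper_function:
  fixes g :: "real \<Rightarrow> real"
  assumes pq: "p \<le> q" and g: "g integrable_on {p..q}" and g0: "\<And>x. x \<in> {p..q} \<Longrightarrow> 0 \<le> g x"
    and "e > 0"
  obtains U where "continuous_on {p..q} U"
    and "\<And>x. x \<in> {p..<q} \<Longrightarrow> ereal (g x) \<le> lower_LD_right (q - x) U x"
    and "U q - U p \<le> integral {p..q} g + e"
proof -
  (* The total error is \<epsilon> (q - p) from the linear term and at most \<epsilon> from the sets G n - E n. *)
  define \<epsilon> where "\<epsilon> = e / (q - p + 1)"
  have \<epsilon>: "\<epsilon> > 0" "\<epsilon> * (q - p + 1) = e"
    using assms by (auto simp: \<epsilon>_def)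
  define E where "E n = {x \<in> {p..q}. real (Suc n) * \<epsilon> \<le> g x}" for n
  have E: "E n \<in> lmeasurable" for n
  proof -
    have [measurable]: "g \<in> borel_measurable (lebesgue_on {p..q})"
      using g by (rule integrable_imp_measurable)
    have "{x \<in> space (lebesgue_on {p..q}). real (Suc n) * \<epsilon> \<le> g x} \<in> sets (lebesgue_on {p..q})"
      by measurable
    then have "E n \<in> sets lebesgue"
      by (simp add: E_def sets_restrict_space_iff)
    moreover have "E n \<subseteq> {p..q}" by (auto simp: E_def)
    ultimately show ?thesis
      by (meson fmeasurableI2 lmeasurable_interval(1) lmeasurable_cbox cbox_interval)
  qed
  have "\<exists>T. open T \<and> E n \<subseteq> T \<and> T - E n \<in> lmeasurable \<and> measure lebesgue (T - E n) \<le> (1 / 2) ^ Suc n" for n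
  proof -
    obtain T where T: "open T" "E n \<subseteq> T" "T - E n \<in> lmeasurable"
        "emeasure lebesgue (T - E n) < ennreal ((1 / 2) ^ Suc n)"
      using sets_lebesgue_outer_open[OF fmeasurableD[OF E], of "(1 / 2) ^ Suc n" n] by auto
    then have "measure lebesgue (T - E n) \<le> (1 / 2) ^ Suc n"
      by (simp add: emeasure_eq_measure2 ennreal_less_iff less_imp_le)
    with T show ?thesis by blast
  qed
  then obtain G where G: "\<And>n. open (G n)" "\<And>n. E n \<subseteq> G n" "\<And>n. G n - E n \<in> lmeasurable"
      "\<And>n. measure lebesgue (G n - E n) \<le> (1 / 2) ^ Suc n"
    by metis
  define m where "m n x = measure lebesgue (G n \<inter> {p..x})" for n x
  have Gm: "G n \<inter> A \<in> lmeasurable" if "A \<in> lmeasurable" for n A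
    using that G(1) by (metis Int_commute borel_open fmeasurable_Int_fmeasurable sets_completionI_sets sets_lborel)
  have Ioc: "{u<..v} \<in> lmeasurable" for u v :: real
    by (cases "u \<le> v") (auto simp: fmeasurable_def)
  have m_diff: "m n y - m n x = measure lebesgue (G n \<inter> {x<..y})" if "p \<le> x" "x \<le> y" for n x y
  proof -
    have "G n \<inter> {p..y} = (G n \<inter> {p..x}) \<union> (G n \<inter> {x<..y})"
      using that by auto
    moreover have "measure lebesgue ((G n \<inter> {p..x}) \<union> (G n \<inter> {x<..y}))
        = measure lebesgue (G n \<inter> {p..x}) + measure lebesgue (G n \<inter> {x<..y})"
      using Gm[of "{p..x}" n] Gm[OF Ioc, of n x y]
      by (intro measure_Union) (auto simp del: emeasure_completion dest: fmeasurableD fmeasurableD2)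
    ultimately show ?thesis by (simp add: m_def)
  qed
  have m_diff_le: "0 \<le> m n y - m n x" "m n y - m n x \<le> y - x" if "p \<le> x" "x \<le> y" for n x y
  proof -
    have "measure lebesgue (G n \<inter> {x<..y}) \<le> measure lebesgue {x<..y}"
      by (intro measure_mono_fmeasurable) (auto intro!: Gm Ioc fmeasurableD)
    then show "m n y - m n x \<le> y - x"
      using that by (simp add: m_diff)
    show "0 \<le> m n y - m n x"
      using that by (simp add: m_diff)
  qed
  have m_diff_eq: "m n y - m n x = y - x" if "p \<le> x" "x \<le> y" "{x<..y} \<subseteq> G n" for n x y
    using that by (simp add: m_diff Int_absorb1)
  have m_bounds: "0 \<le> m n x" "m n x \<le> m n q" if "x \<in> {p..q}" for n x
    using m_diff_le(1)[of x q n] that by (auto simp: m_def)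
  have m_cont: "continuous_on {p..q} (m n)" for n
  proof (rule continuous_on_iff[THEN iffD2], intro ballI allI impI)
    fix x and r :: real assume x: "x \<in> {p..q}" and "r > 0"
    have "dist (m n y) (m n x) \<le> dist y x" if "y \<in> {p..q}" for y
      using m_diff_le[of x y n] m_diff_le[of y x n] x that by (auto simp: dist_real_def abs_if)
    then show "\<exists>d>0. \<forall>y\<in>{p..q}. dist y x < d \<longrightarrow> dist (m n y) (m n x) < r"
      using \<open>r > 0\<close> by (meson le_less_trans)
  qed
  have m_q: "m n q \<le> measure lebesgue (E n) + (1 / 2) ^ Suc n" for n
  proof -
    have "E n \<union> (G n - E n) \<in> lmeasurable"
      by (intro fmeasurable.Un E G(3))
    then have "m n q \<le> measure lebesgue (E n \<union> (G n - E n))"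
      unfolding m_def by (rule measure_mono_fmeasurable[rotated 2]) (auto intro!: fmeasurableD Gm)
    also have "\<dots> \<le> measure lebesgue (E n) + measure lebesgue (G n - E n)"
      using E G(3) by (intro measure_Un_le) (auto intro!: fmeasurableD)
    finally show ?thesis using G(4)[of n] by simp
  qed
  have E_sum: "(\<Sum>n<N. \<epsilon> * measure lebesgue (E n)) \<le> integral {p..q} g" for N
  proof -
    have EI: "E n \<inter> {p..q} = E n" for n by (auto simp: E_def)
    have int: "(\<lambda>x. \<epsilon> * indicat_real (E n) x) integrable_on {p..q}" for n
      using integrable_on_indicator[of "E n" "{p..q}"] E
      by (intro integrable_on_mult_right) (simp add: EI)
    have "(\<Sum>n<N. \<epsilon> * measure lebesgue (E n)) = (\<Sum>n<N. integral {p..q} (\<lambda>x. \<epsilon> * indicat_real (E n) x))"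
      using Equivalence_Lebesgue_Henstock_Integration.integral_indicator[of "E _" "{p..q}"] E
      by (simp add: EI)
    also have "\<dots> = integral {p..q} (\<lambda>x. \<Sum>n<N. \<epsilon> * indicat_real (E n) x)"
      by (rule integral_sum[symmetric]) (auto intro: int)
    also have "\<dots> \<le> integral {p..q} g"
    proof (rule integral_le[OF _ g])
      show "(\<lambda>x. \<Sum>n<N. \<epsilon> * indicat_real (E n) x) integrable_on {p..q}"
        by (intro integrable_sum int) auto
      fix x assume x: "x \<in> {p..q}"
      \<comment> \<open>the second bound makes the induction work: when \<open>x \<in> E N\<close>, adding \<open>\<epsilon>\<close> to \<open>N \<epsilon>\<close> stays below \<open>g x\<close>\<close>
      have "(\<Sum>n<N. \<epsilon> * indicat_real (E n) x) \<le> g x \<and> (\<Sum>n<N. \<epsilon> * indicat_real (E n) x) \<le> real N * \<epsilon>"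
      proof (induction N)
        case (Suc N)
        have "real (Suc N) * \<epsilon> = real N * \<epsilon> + \<epsilon>"
          by (simp add: algebra_simps)
        moreover have "\<epsilon> * indicat_real (E N) x = \<epsilon> \<and> real (Suc N) * \<epsilon> \<le> g x
            \<or> \<epsilon> * indicat_real (E N) x = 0"
          by (auto simp: indicator_def E_def)
        ultimately show ?case
          using Suc.IH \<epsilon>(1) unfolding sum.lessThan_Suc by linarith
      qed (use g0[OF x] in simp)
      then show "(\<Sum>n<N. \<epsilon> * indicat_real (E n) x) \<le> g x" by blast
    qed
    finally show ?thesis .
  qed
  have sum_le: "(\<Sum>n<N. \<epsilon> * m n q) \<le> integral {p..q} g + \<epsilon>" for N
  proof -
    have "(\<Sum>n<N. \<epsilon> * m n q) \<le> (\<Sum>n<N. \<epsilon> * measure lebesgue (E n) + \<epsilon> * (1 / 2) ^ Suc n)"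
      using m_q \<epsilon>(1) by (intro sum_mono) (metis distrib_left less_imp_le mult_left_mono)
    also have "\<dots> = (\<Sum>n<N. \<epsilon> * measure lebesgue (E n)) + \<epsilon> * (\<Sum>n<N. (1 / 2) ^ Suc n)"
      by (simp add: sum.distrib sum_distrib_left)
    also have "(\<Sum>n<N. (1 / 2 :: real) ^ Suc n) = 1 - (1 / 2) ^ N"
      by (induction N) (auto simp: field_simps)
    also have "(\<Sum>n<N. \<epsilon> * measure lebesgue (E n)) + \<epsilon> * (1 - (1 / 2) ^ N) \<le> integral {p..q} g + \<epsilon> * 1"
      using E_sum \<epsilon>(1) by (intro add_mono mult_left_mono) auto
    finally show ?thesis by simp
  qed
  have nonneg: "0 \<le> \<epsilon> * m n x" for n x
    using \<epsilon>(1) by (simp add: m_def)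
  have summable_q: "summable (\<lambda>n. \<epsilon> * m n q)"
    by (rule summableI_nonneg_bounded[OF nonneg sum_le])
  have m_le: "norm (\<epsilon> * m n x) \<le> \<epsilon> * m n q" if "x \<in> {p..q}" for n x
    using \<epsilon>(1) m_bounds[OF that, of n] by simp
  have summable: "summable (\<lambda>n. \<epsilon> * m n x)" if "x \<in> {p..q}" for x
    by (rule summable_comparison_test'[OF summable_q, of 0]) (rule m_le[OF that])
  define U where "U x = \<epsilon> * x + (\<Sum>n. \<epsilon> * m n x)" for x
  show thesis
  proof
    have "uniform_limit {p..q} (\<lambda>N x. \<Sum>n<N. \<epsilon> * m n x) (\<lambda>x. \<Sum>n. \<epsilon> * m n x) sequentially"
      by (rule Weierstrass_m_test[OF m_le summable_q])
    then have "continuous_on {p..q} (\<lambda>x. \<Sum>n. \<epsilon> * m n x)"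
      by (rule uniform_limit_theorem[rotated]) (auto intro!: always_eventually continuous_intros m_cont)
    then show cont: "continuous_on {p..q} U"
      unfolding U_def by (intro continuous_intros)
    show "U q - U p \<le> integral {p..q} g + e"
    proof -
      have "0 \<le> (\<Sum>n. \<epsilon> * m n p)"
        using pq by (intro suminf_nonneg summable nonneg) auto
      moreover have "(\<Sum>n. \<epsilon> * m n q) \<le> integral {p..q} g + \<epsilon>"
        by (rule suminf_le_const[OF summable_q sum_le])
      ultimately show ?thesis
        using \<epsilon>(2) by (simp add: U_def algebra_simps)
    qed
    fix x assume x: "x \<in> {p..<q}"
    define N where "N = nat \<lfloor>g x / \<epsilon>\<rfloor>"
    have "0 \<le> g x / \<epsilon>" using g0[of x] x \<epsilon>(1) by simp
    then have "real N \<le> g x / \<epsilon>" "g x / \<epsilon> \<le> real N + 1"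
      unfolding N_def by linarith+
    then have N: "real N * \<epsilon> \<le> g x" "g x \<le> (real N + 1) * \<epsilon>"
      using \<epsilon>(1) by (simp_all add: field_simps)
    have "x \<in> E n" if "n < N" for n
    proof -
      have "real (Suc n) * \<epsilon> \<le> real N * \<epsilon>"
        using that \<epsilon>(1) by (intro mult_right_mono) auto
      then show ?thesis using N(1) x by (auto simp: E_def)
    qed
    then have "x \<in> (\<Inter>n<N. G n)" using G(2) by blast
    moreover have "open (\<Inter>n<N. G n)" using G(1) by (intro open_INT) auto
    ultimately obtain r where r: "r > 0" "ball x r \<subseteq> (\<Inter>n<N. G n)"
      by (meson openE)
    show "ereal (g x) \<le> lower_LD_right (q - x) U x"
    proof (rule lower_LD_right_ge_slope)
      show "continuous_on {x..x + (q - x)} U"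
        using x by (auto intro: continuous_on_subset[OF cont])
      show "0 < min (q - x) (r / 2)" "min (q - x) (r / 2) \<le> q - x"
        using r x by auto
      fix t assume t: "0 \<le> t" "t \<le> min (q - x) (r / 2)"
      have xt: "x \<in> {p..q}" "x + t \<in> {p..q}" using x t by auto
      have "{x<..x + t} \<subseteq> ball x r" using t r by (auto simp: dist_real_def)
      then have sub: "{x<..x + t} \<subseteq> G n" if "n < N" for n
        using r(2) that by blast
      have "g x * t \<le> (real N + 1) * \<epsilon> * t"
        using N(2) t(1) by (rule mult_right_mono)
      also have "\<dots> = \<epsilon> * t + (\<Sum>n<N. \<epsilon> * m n (x + t) - \<epsilon> * m n x)"
        using m_diff_eq[of x "x + t", OF _ _ sub] xt t(1)
        by (simp add: right_diff_distrib[symmetric] algebra_simps)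
      also have "(\<Sum>n<N. \<epsilon> * m n (x + t) - \<epsilon> * m n x) \<le> (\<Sum>n. \<epsilon> * m n (x + t) - \<epsilon> * m n x)"
      proof (rule sum_le_suminf)
        show "summable (\<lambda>n. \<epsilon> * m n (x + t) - \<epsilon> * m n x)"
          by (intro summable_diff summable xt)
        show "0 \<le> \<epsilon> * m n (x + t) - \<epsilon> * m n x" for n
          using m_diff_le(1)[of x "x + t" n] xt t(1) \<epsilon>(1) by simp
      qed auto
      also have "\<dots> = (\<Sum>n. \<epsilon> * m n (x + t)) - (\<Sum>n. \<epsilon> * m n x)"
        by (intro suminf_diff[symmetric] summable xt)
      finally show "g x * t \<le> U (x + t) - U x"
        by (simp add: U_def algebra_simps)
    qed
  qed
qed

text \<open>
  After adding \<open>M\<close> the function \<open>g\<close> is nonnegative, so the previous construction applies to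
  \<open>g + M\<close>; the resulting function, corrected by \<open>- M x\<close>, dominates all minor functions of
  \<open>h\<close> and its increment exceeds the integral of \<open>g\<close> by as little as desired.
\<close>

lemma Laplace_integral_le_integral:
  assumes pq: "p \<le> q" and h: "Laplace_integrable h p q" and g: "g integrable_on {p..q}"
    and hg: "\<And>x. x \<in> {p..q} \<Longrightarrow> h x \<le> g x" and M: "\<And>x. x \<in> {p..q} \<Longrightarrow> - M \<le> g x"
  shows "Laplace_integral h p q \<le> integral {p..q} g"
proof (rule field_le_epsilon)
  fix e :: real assume "e > 0"
  then have e2: "e / 2 > 0" by simp
  have "(\<lambda>x. g x + M) integrable_on {p..q}"
    by (intro integrable_add g integrable_const_ivl)
  moreover have "0 \<le> g x + M" if "x \<in> {p..q}" for x
    using M[OF that] by simp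
  ultimately obtain U0 where U0: "continuous_on {p..q} U0"
      "\<And>x. x \<in> {p..<q} \<Longrightarrow> ereal (g x + M) \<le> lower_LD_right (q - x) U0 x"
      "U0 q - U0 p \<le> integral {p..q} (\<lambda>x. g x + M) + e / 2"
    using layer_cake_upper_function[OF pq _ _ e2] by blast
  define U where "U x = U0 x - M * x" for x
  have Uc: "continuous_on {p..q} U"
    unfolding U_def by (intro continuous_intros U0)
  obtain V where V: "Laplace_minor h p q V" "Laplace_integral h p q - e / 2 < V q - V p"
    using Laplace_integrable_integral[OF h] e2 unfolding has_Laplace_integral_iff[OF pq] by blast
  have "V q - V p \<le> U q - U p"
  proof (rule increment_le_if_lower_LD_right[OF pq Uc, where f = g])
    show "continuous_on {p..q} V"
      using V(1) by (simp add: Laplace_minor_def)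
    fix x assume x: "x \<in> {p..<q}"
    have "ereal (1 * (g x + M) + - M) \<le> lower_LD_right (q - x) U x"
    proof (rule lower_LD_right_perturb[where U = U0])
      show "continuous_on {x..x + (q - x)} U0" "continuous_on {x..x + (q - x)} U"
        using x by (auto intro: continuous_on_subset[OF U0(1)] continuous_on_subset[OF Uc])
      show "((\<lambda>z. U z - 1 * U0 z) has_real_derivative - M) (at x within {x..x + (q - x)})"
        unfolding U_def by (auto intro!: derivative_eq_intros)
    qed (use x U0(2)[OF x] in auto)
    then show "ereal (g x) \<le> lower_LD_right (q - x) U x" by simp
    have "ereal (- g x) \<le> ereal (- h x)" using hg[of x] x by simp
    also have "\<dots> \<le> lower_LD_right (q - x) (\<lambda>x. - V x) x"
      using x V(1) by (auto simp: Laplace_minor_iff_major_uminus Laplace_major_iff ereal_le_lower_LD_iff)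
    finally show "ereal (- g x) \<le> lower_LD_right (q - x) (\<lambda>x. - V x) x" .
  qed
  moreover have "integral {p..q} (\<lambda>x. g x + M) = integral {p..q} g + M * (q - p)"
    using pq by (subst integral_add[OF g]) auto
  ultimately show "Laplace_integral h p q \<le> integral {p..q} g + e"
    using V(2) U0(3) by (simp add: U_def algebra_simps)
qed

lemma abs_Laplace_integral_le_integral:
  assumes "p \<le> q" "Laplace_integrable h p q" "g integrable_on {p..q}"
    and "\<And>x. x \<in> {p..q} \<Longrightarrow> \<bar>h x\<bar> \<le> g x"
  shows "\<bar>Laplace_integral h p q\<bar> \<le> integral {p..q} g"
proof -
  have "0 \<le> g x" "h x \<le> g x" "- h x \<le> g x" if "x \<in> {p..q}" for x
    using assms(4)[OF that] by auto
  then have "Laplace_integral h p q \<le> integral {p..q} g"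
    "Laplace_integral (\<lambda>x. - h x) p q \<le> integral {p..q} g"
    using assms by (auto intro!: Laplace_integral_le_integral[where M = 0] Laplace_integrable_uminus)
  then show ?thesis
    by (simp add: Laplace_integral_uminus[OF assms(1,2)] abs_le_iff)
qed

text \<open>
  Compare \<open>h\<close> and \<open>- h\<close> with themselves.
\<close>

lemma Laplace_integral_eq_integral_if_bounded:
  assumes "p \<le> q" "Laplace_integrable h p q" "h integrable_on {p..q}"
    and "\<And>x. x \<in> {p..q} \<Longrightarrow> \<bar>h x\<bar> \<le> M"
  shows "Laplace_integral h p q = integral {p..q} h"
proof (rule antisym)
  have M: "- M \<le> h x" "- M \<le> - h x" if "x \<in> {p..q}" for x
    using assms(4)[OF that] by auto
  show "Laplace_integral h p q \<le> integral {p..q} h"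
    by (rule Laplace_integral_le_integral[OF assms(1-3) order_refl M(1)])
  have "Laplace_integral (\<lambda>x. - h x) p q \<le> integral {p..q} (\<lambda>x. - h x)"
    using assms M(2)
    by (intro Laplace_integral_le_integral[where M = M] Laplace_integrable_uminus integrable_neg) auto
  then show "integral {p..q} h \<le> Laplace_integral h p q"
    by (simp add: Laplace_integral_uminus[OF assms(1,2)])
qed

section \<open>Functions of bounded variation on a half-line\<close>

lemma bounded_variation_on_reflect:
  assumes "bounded_variation_on S f" and S: "\<And>x. x \<in> S \<Longrightarrow> - x \<in> S"
  shows "bounded_variation_on S (\<lambda>x. f (- x))"
proof -
  obtain B where B: "\<And>n x. (\<forall>i\<le>n. x i \<in> S) \<and> (\<forall>i<n. x i \<le> x (Suc i)) \<Longrightarrow>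
      (\<Sum>i<n. \<bar>f (x (Suc i)) - f (x i)\<bar>) \<le> B"
    using assms(1) unfolding bounded_variation_on_def by blast
  have "(\<Sum>i<n. \<bar>f (- x (Suc i)) - f (- x i)\<bar>) \<le> B"
    if x: "\<forall>i\<le>n. x i \<in> S" "\<forall>i<n. x i \<le> x (Suc i)" for n x
  proof -
    define z where "z i = - x (n - i)" for i
    have "(\<forall>i\<le>n. z i \<in> S) \<and> (\<forall>i<n. z i \<le> z (Suc i))"
    proof (intro conjI allI impI)
      show "z i \<in> S" if "i \<le> n" for i
        using x(1) S by (simp add: z_def)
      show "z i \<le> z (Suc i)" if "i < n" for i
        using x(2)[rule_format, of "n - Suc i"] that by (simp add: z_def Suc_diff_Suc)
    qed
    from B[OF this] have "(\<Sum>i<n. \<bar>f (z (Suc i)) - f (z i)\<bar>) \<le> B" .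
    also have "(\<Sum>i<n. \<bar>f (z (Suc i)) - f (z i)\<bar>) = (\<Sum>i<n. \<bar>f (z (Suc (n - Suc i))) - f (z (n - Suc i))\<bar>)"
      by (rule sum.nat_diff_reindex[symmetric])
    also have "\<dots> = (\<Sum>i<n. \<bar>f (- x (Suc i)) - f (- x i)\<bar>)"
      by (intro sum.cong) (auto simp: z_def Suc_diff_Suc abs_minus_commute)
    finally show ?thesis .
  qed
  then show ?thesis unfolding bounded_variation_on_def by blast
qed

lemma bounded_variation_on_subset:
  "bounded_variation_on S f \<Longrightarrow> T \<subseteq> S \<Longrightarrow> bounded_variation_on T f"
  unfolding bounded_variation_on_def by (meson subsetD)

text \<open>
  The Jordan decomposition \<open>f = (f + T) - T\<close>, where \<open>T y\<close> is the variation of \<open>f\<close> on \<open>[a, y]\<close>.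
\<close>

lemma bounded_variation_on_atLeast_decompose:
  assumes "bounded_variation_on {a..} f"
  obtains g h B where "mono_on {a..} g" "mono_on {a..} h" "\<And>x. x \<ge> a \<Longrightarrow> f x = g x - h x"
    "\<And>x. x \<ge> a \<Longrightarrow> \<bar>g x\<bar> \<le> B" "\<And>x. x \<ge> a \<Longrightarrow> \<bar>h x\<bar> \<le> B"
proof -
  obtain B where B: "\<And>n x. (\<forall>i\<le>n. x i \<in> {a..}) \<and> (\<forall>i<n. x i \<le> x (Suc i)) \<Longrightarrow>
      (\<Sum>i<n. \<bar>f (x (Suc i)) - f (x i)\<bar>) \<le> B"
    using assms unfolding bounded_variation_on_def by blast
  define VS where "VS y = {\<Sum>i<n. \<bar>f (x (Suc i)) - f (x i)\<bar> | n x.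
      (\<forall>i\<le>n. x i \<in> {a..y}) \<and> (\<forall>i<n. x i \<le> x (Suc i))}" for y
  define T where "T y = Sup (VS y)" for y
  have VS_le: "s \<le> B" if "s \<in> VS y" for s y
    using that B by (fastforce simp: VS_def)
  then have bdd: "bdd_above (VS y)" for y
    by (meson bdd_aboveI)
  have VS0: "0 \<in> VS y" if "a \<le> y" for y
    using that unfolding VS_def by (auto intro!: exI[of _ 0] exI[of _ "\<lambda>_. a"])
  have T0: "0 \<le> T y" and TB: "T y \<le> B" if "a \<le> y" for y
    using VS0[OF that] VS_le bdd unfolding T_def by (auto intro: cSup_upper cSup_least)
  have step: "T x + \<bar>f y - f x\<bar> \<le> T y" if xy: "a \<le> x" "x \<le> y" for x y
  proof -
    have "T x \<le> T y - \<bar>f y - f x\<bar>"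
      unfolding T_def[of x]
    proof (rule cSup_least)
      show "VS x \<noteq> {}" using VS0 xy by blast
      fix s assume "s \<in> VS x"
      then obtain n u where u: "\<forall>i\<le>n. u i \<in> {a..x}" "\<forall>i<n. u i \<le> u (Suc i)"
        and s: "s = (\<Sum>i<n. \<bar>f (u (Suc i)) - f (u i)\<bar>)"
        unfolding VS_def by blast
      \<comment> \<open>a chain in \<open>[a, x]\<close> prolonged by \<open>x\<close> and \<open>y\<close> is a chain in \<open>[a, y]\<close>\<close>
      define z where "z i = (if i \<le> n then u i else if i = Suc n then x else y)" for i
      have "(\<forall>i\<le>Suc (Suc n). z i \<in> {a..y}) \<and> (\<forall>i<Suc (Suc n). z i \<le> z (Suc i))"
      proof (intro conjI allI impI)
        show "z i \<in> {a..y}" for i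
          using u(1)[rule_format, of i] xy by (auto simp: z_def)
        show "z i \<le> z (Suc i)" if "i < Suc (Suc n)" for i
          using u(1)[rule_format, of n] u(2)[rule_format, of i] xy that by (auto simp: z_def)
      qed
      then have "(\<Sum>i<Suc (Suc n). \<bar>f (z (Suc i)) - f (z i)\<bar>) \<in> VS y"
        unfolding VS_def by blast
      then have "(\<Sum>i<Suc (Suc n). \<bar>f (z (Suc i)) - f (z i)\<bar>) \<le> T y"
        unfolding T_def by (rule cSup_upper[OF _ bdd])
      moreover have "(\<Sum>i<n. \<bar>f (z (Suc i)) - f (z i)\<bar>) = s"
        unfolding s by (intro sum.cong) (auto simp: z_def)
      moreover have "\<bar>f (z (Suc (Suc n))) - f (z (Suc n))\<bar> = \<bar>f y - f x\<bar>"
        by (simp add: z_def)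
      ultimately show "s \<le> T y - \<bar>f y - f x\<bar>" by simp
    qed
    then show ?thesis by simp
  qed
  have f_le: "\<bar>f x\<bar> \<le> \<bar>f a\<bar> + B" if "a \<le> x" for x
    using step[of a x] T0[of a] TB[of x] that by linarith
  show thesis
  proof (rule that[of "\<lambda>x. f x + T x" T "\<bar>f a\<bar> + 2 * B"])
    show "mono_on {a..} (\<lambda>x. f x + T x)"
    proof (rule mono_onI)
      show "f x + T x \<le> f y + T y" if "x \<in> {a..}" "y \<in> {a..}" "x \<le> y" for x y
        using step[of x y] that by auto
    qed
    show "mono_on {a..} T"
    proof (rule mono_onI)
      show "T x \<le> T y" if "x \<in> {a..}" "y \<in> {a..}" "x \<le> y" for x y
        using step[of x y] that by auto
    qed
    show "\<bar>f x + T x\<bar> \<le> \<bar>f a\<bar> + 2 * B" if "a \<le> x" for x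
      using f_le[OF that] T0[OF that] TB[OF that] by linarith
    show "\<bar>T x\<bar> \<le> \<bar>f a\<bar> + 2 * B" if "a \<le> x" for x
      using f_le[OF that] T0[OF that] TB[OF that] by linarith
  qed simp
qed

lemma mono_on_bounded_tendsto_at_top:
  fixes g :: "real \<Rightarrow> real"
  assumes g: "mono_on {a..} g" and B: "\<And>x. x \<ge> a \<Longrightarrow> g x \<le> B"
  obtains L where "(g \<longlongrightarrow> L) at_top"
proof -
  have bdd: "bdd_above (g ` {a..})"
    using B by (auto intro!: bdd_aboveI[of _ B])
  have "(g \<longlongrightarrow> Sup (g ` {a..})) at_top"
  proof (rule increasing_tendsto)
    show "\<forall>\<^sub>F x in at_top. g x \<le> Sup (g ` {a..})"
      using eventually_ge_at_top[of a] by eventually_elim (auto intro: cSup_upper bdd)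
    fix y assume "y < Sup (g ` {a..})"
    then obtain x where x: "x \<ge> a" "y < g x"
      using less_cSup_iff[OF _ bdd] by auto
    show "\<forall>\<^sub>F z in at_top. y < g z"
      using eventually_ge_at_top[of x]
    proof eventually_elim
      case (elim z)
      then show ?case using mono_onD[OF g, of x z] x by auto
    qed
  qed
  then show thesis by (rule that)
qed

section \<open>Convergence at infinity\<close>

text \<open>
  Cauchy's criterion for the improper integral.
\<close>

lemma has_Laplace_integral_atLeast_if_small_tails:
  assumes h: "\<And>c. p \<le> c \<Longrightarrow> Laplace_integrable h p c"
    and tails: "\<And>e. e > 0 \<Longrightarrow> \<exists>C. \<forall>c d. p \<le> c \<longrightarrow> C \<le> c \<longrightarrow> c \<le> d \<longrightarrow> \<bar>Laplace_integral h c d\<bar> < e"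
  shows "\<exists>I. has_Laplace_integral_atLeast h p I"
proof -
  define F where "F c = Laplace_integral h p c" for c
  have F_diff: "F d - F c = Laplace_integral h c d" if "p \<le> c" "c \<le> d" for c d
    using Laplace_integral_combine[OF h[of d]] that by (simp add: F_def)
  have "\<exists>L. (F \<longlongrightarrow> L) at_top"
  proof -
    define X where "X n = F (p + real n)" for n :: nat
    have C: "\<exists>N::nat. \<forall>c d. p + real N \<le> c \<longrightarrow> p + real N \<le> d \<longrightarrow> \<bar>F d - F c\<bar> < e" if e: "e > 0" for e
    proof -
      obtain C where C: "\<And>c d. p \<le> c \<Longrightarrow> C \<le> c \<Longrightarrow> c \<le> d \<Longrightarrow> \<bar>Laplace_integral h c d\<bar> < e"
        using tails[OF e] by blast
      obtain N :: nat where N: "C - p \<le> real N" using real_arch_simple by blast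
      have "\<bar>F d - F c\<bar> < e" if "p + real N \<le> c" "p + real N \<le> d" for c d
        using C[of c d] C[of d c] F_diff[of c d] F_diff[of d c] N that
        by (cases "c \<le> d") auto
      then show ?thesis by blast
    qed
    have "Cauchy X"
      unfolding Cauchy_iff2
    proof (intro allI)
      fix j :: nat
      obtain N :: nat where N: "\<And>c d. p + real N \<le> c \<Longrightarrow> p + real N \<le> d \<Longrightarrow> \<bar>F d - F c\<bar> < inverse (real (Suc j))"
        using C[of "inverse (real (Suc j))"] by auto
      show "\<exists>M. \<forall>m\<ge>M. \<forall>n\<ge>M. \<bar>X m - X n\<bar> < inverse (real (Suc j))"
        unfolding X_def by (intro exI[of _ N] allI impI N) simp_all
    qed
    then obtain L where L: "X \<longlonglongrightarrow> L"
      using Cauchy_convergent convergent_def by blast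
    have "(F \<longlongrightarrow> L) at_top"
    proof (rule tendstoI)
      fix e :: real assume "e > 0"
      then have e2: "e / 2 > 0" by simp
      obtain N :: nat where N: "\<And>c d. p + real N \<le> c \<Longrightarrow> p + real N \<le> d \<Longrightarrow> \<bar>F d - F c\<bar> < e / 2"
        using C[OF e2] by blast
      have "\<forall>\<^sub>F n in sequentially. N \<le> n \<and> dist (X n) L < e / 2"
        using eventually_ge_at_top[of N] tendstoD[OF L e2] by eventually_elim simp
      then obtain n where n: "N \<le> n" "dist (X n) L < e / 2"
        using eventually_happens'[OF sequentially_bot] by blast
      show "\<forall>\<^sub>F c in at_top. dist (F c) L < e"
        using eventually_ge_at_top[of "p + real N"]
      proof eventually_elim
        case (elim c)
        have "\<bar>F c - X n\<bar> < e / 2"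
          unfolding X_def using n(1) elim by (intro N) auto
        then show ?case using n(2) unfolding dist_real_def by linarith
      qed
    qed
    then show ?thesis by blast
  qed
  then show ?thesis
    using h unfolding has_Laplace_integral_atLeast_def F_def by blast
qed

lemma Laplace_integral_tail_tendsto_0:
  assumes "has_Laplace_integral_atLeast f p I"
  shows "((\<lambda>c. Laplace_integral f c (c + 1)) \<longlongrightarrow> 0) at_top"
proof -
  have f: "\<And>c. p \<le> c \<Longrightarrow> Laplace_integrable f p c"
    and lim: "((\<lambda>c. Laplace_integral f p c) \<longlongrightarrow> I) at_top"
    using assms by (auto simp: has_Laplace_integral_atLeast_def)
  have "LIM c at_top. 1 + c :> (at_top :: real filter)"
    by (rule filterlim_tendsto_add_at_top[OF tendsto_const filterlim_ident])
  then have "((\<lambda>c. Laplace_integral f p (c + 1)) \<longlongrightarrow> I) at_top"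
    by (intro filterlim_compose[OF lim]) (simp add: add.commute)
  from tendsto_diff[OF this lim]
  have "((\<lambda>c. Laplace_integral f p (c + 1) - Laplace_integral f p c) \<longlongrightarrow> 0) at_top" by simp
  moreover have "\<forall>\<^sub>F c in at_top. Laplace_integral f p (c + 1) - Laplace_integral f p c
      = Laplace_integral f c (c + 1)"
    using eventually_ge_at_top[of p]
  proof eventually_elim
    case (elim c)
    then show ?case using Laplace_integral_combine[OF f[of "c + 1"], of c] by simp
  qed
  ultimately show ?thesis by (rule Lim_transform_eventually)
qed

text \<open>
  If \<open>f\<close> stayed above a positive constant, or below a negative one, then so would its integrals over
  \<open>[c, c + 1]\<close>, which tend to \<open>0\<close>.
\<close>

lemma tendsto_0_if_has_Laplace_integral_atLeast:
  assumes I: "has_Laplace_integral_atLeast f p I" and L: "(f \<longlongrightarrow> L) at_top"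
  shows "L = 0"
proof -
  have f: "\<And>c. p \<le> c \<Longrightarrow> Laplace_integrable f p c"
    using I by (auto simp: has_Laplace_integral_atLeast_def)
  have le: "M \<le> 0" if M: "M < K" and K: "(g \<longlongrightarrow> K) at_top"
    and g: "\<And>c. p \<le> c \<Longrightarrow> Laplace_integrable g p c"
    and g0: "((\<lambda>c. Laplace_integral g c (c + 1)) \<longlongrightarrow> 0) at_top" for M K g
  proof (rule tendsto_lowerbound[OF g0])
    obtain C where C: "\<And>x. C \<le> x \<Longrightarrow> M < g x"
      using order_tendstoD(1)[OF K M] by (auto simp: eventually_at_top_linorder)
    show "\<forall>\<^sub>F c in at_top. M \<le> Laplace_integral g c (c + 1)"
      using eventually_ge_at_top[of "max C p"]
    proof eventually_elim
      case (elim c)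
      have gc: "Laplace_integrable g c (c + 1)"
        by (rule Laplace_integrable_restrict[OF g[of "c + 1"]]) (use elim in auto)
      have "Laplace_integral (\<lambda>x. - g x) c (c + 1) \<le> integral {c..c + 1} (\<lambda>x. - M)"
        using elim C by (intro Laplace_integral_le_integral[where M = M] Laplace_integrable_uminus gc) 
          (auto intro!: less_imp_le)
      then show ?case
        using Laplace_integral_uminus[OF _ gc] by simp
    qed
  qed simp
  have "\<not> L > 0"
  proof
    assume "L > 0"
    then show False
      using le[of "L / 2", OF _ L f Laplace_integral_tail_tendsto_0[OF I]] by simp
  qed
  moreover have "\<not> L < 0"
  proof
    assume "L < 0"
    have "((\<lambda>c. Laplace_integral (\<lambda>x. - f x) c (c + 1)) \<longlongrightarrow> 0) at_top"
    proof (rule Lim_transform_eventually)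
      show "((\<lambda>c. - Laplace_integral f c (c + 1)) \<longlongrightarrow> 0) at_top"
        using tendsto_minus[OF Laplace_integral_tail_tendsto_0[OF I]] by simp
      show "\<forall>\<^sub>F c in at_top. - Laplace_integral f c (c + 1) = Laplace_integral (\<lambda>x. - f x) c (c + 1)"
        using eventually_ge_at_top[of p]
      proof eventually_elim
        case (elim c)
        have "Laplace_integrable f c (c + 1)"
          by (rule Laplace_integrable_restrict[OF f[of "c + 1"]]) (use elim in auto)
        then show ?case by (simp add: Laplace_integral_uminus)
      qed
    qed
    then show False
      using le[of "- L / 2" "- L" "\<lambda>x. - f x", OF _ tendsto_minus[OF L]] \<open>L < 0\<close> f
      by (auto simp: Laplace_integrable_uminus)
  qed
  ultimately show ?thesis by linarith
qed

text \<open>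
  Local integrability comes from the product theorem.  The tails are bounded by those of the Lebesgue
  integral of \<open>\<bar>f\<bar>\<close>, because the sine has absolute value at most \<open>1\<close>.
\<close>

lemma has_Laplace_integral_atLeast_mult_sin_if_Lebesgue:
  assumes f: "\<And>c. p \<le> c \<Longrightarrow> Laplace_integrable f p c" and L: "set_integrable lebesgue {a..} f"
  shows "\<exists>I. has_Laplace_integral_atLeast (\<lambda>x. f x * sin (\<omega> * x + \<theta>)) p I"
proof (rule has_Laplace_integral_atLeast_if_small_tails)
  show fs: "Laplace_integrable (\<lambda>x. f x * sin (\<omega> * x + \<theta>)) p c" if "p \<le> c" for c
    by (rule Laplace_integrable_mult_sin[OF that f[OF that]])
  fix e :: real assume e: "e > 0"
  have abs: "(\<lambda>x. \<bar>f x\<bar>) integrable_on {a..}"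
    using set_integrable_abs[OF L] by (rule set_lebesgue_integral_eq_integral(1))
  have int: "(\<lambda>x. \<bar>f x\<bar>) integrable_on {c..d}" if "a \<le> c" for c d
    by (rule integrable_on_subinterval[OF abs]) (use that in auto)
  define F where "F c = integral {a..c} (\<lambda>x. \<bar>f x\<bar>)" for c
  have F_diff: "F d - F c = integral {c..d} (\<lambda>x. \<bar>f x\<bar>)" if "a \<le> c" "c \<le> d" for c d
    using Henstock_Kurzweil_Integration.integral_combine[OF that int] by (simp add: F_def)
  have "mono_on {a..} F"
    unfolding F_def by (intro mono_onI integral_subset_le int) auto
  moreover have "F c \<le> integral {a..} (\<lambda>x. \<bar>f x\<bar>)" for c
    unfolding F_def by (intro integral_subset_le int abs) auto
  ultimately obtain K where "(F \<longlongrightarrow> K) at_top"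
    by (rule mono_on_bounded_tendsto_at_top)
  from tendstoD[OF this, of "e / 2"] e obtain C where C: "\<And>c. C \<le> c \<Longrightarrow> dist (F c) K < e / 2"
    by (auto simp: eventually_at_top_linorder)
  show "\<exists>C. \<forall>c d. p \<le> c \<longrightarrow> C \<le> c \<longrightarrow> c \<le> d \<longrightarrow> \<bar>Laplace_integral (\<lambda>x. f x * sin (\<omega> * x + \<theta>)) c d\<bar> < e"
  proof (rule exI[of _ "max a C"], intro allI impI)
    fix c d assume cd: "p \<le> c" "max a C \<le> c" "c \<le> d"
    have "\<bar>Laplace_integral (\<lambda>x. f x * sin (\<omega> * x + \<theta>)) c d\<bar> \<le> integral {c..d} (\<lambda>x. \<bar>f x\<bar>)"
    proof (rule abs_Laplace_integral_le_integral[OF cd(3)])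
      show "Laplace_integrable (\<lambda>x. f x * sin (\<omega> * x + \<theta>)) c d"
        by (rule Laplace_integrable_restrict[OF fs[of d]]) (use cd in auto)
      show "(\<lambda>x. \<bar>f x\<bar>) integrable_on {c..d}" using cd by (intro int) auto
      show "\<bar>f x * sin (\<omega> * x + \<theta>)\<bar> \<le> \<bar>f x\<bar>" for x
        by (simp add: abs_mult mult_left_le)
    qed
    also have "\<dots> = F d - F c" using cd by (intro F_diff[symmetric]) auto
    also have "\<dots> < e"
    proof -
      have "\<bar>F c - K\<bar> < e / 2" "\<bar>F d - K\<bar> < e / 2"
        using C[of c] C[of d] cd by (auto simp: dist_real_def)
      then show ?thesis by linarith
    qed
    finally show "\<bar>Laplace_integral (\<lambda>x. f x * sin (\<omega> * x + \<theta>)) c d\<bar> < e" .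
  qed
qed

text \<open>
  The second mean value theorem replaces the monotone factor by its two endpoint values, and the
  integrals of the sine are bounded by \<open>2 / \<bar>\<omega>\<bar>\<close> independently of the interval.
\<close>

lemma abs_integral_mono_mult_sin_le:
  fixes g :: "real \<Rightarrow> real"
  assumes g: "mono_on {c..d} g" and "c \<le> d" "\<omega> \<noteq> 0" and s: "\<bar>g c\<bar> \<le> s" "\<bar>g d\<bar> \<le> s"
  shows "(\<lambda>x. g x * sin (\<omega> * x + \<theta>)) integrable_on {c..d}"
    and "\<bar>integral {c..d} (\<lambda>x. g x * sin (\<omega> * x + \<theta>))\<bar> \<le> s * (4 / \<bar>\<omega>\<bar>)"
proof -
  have sin: "\<bar>integral {u..v} (\<lambda>x. sin (\<omega> * x + \<theta>))\<bar> \<le> 2 / \<bar>\<omega>\<bar>" if "u \<le> v" for u v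
  proof -
    have "((\<lambda>x. sin (\<omega> * x + \<theta>)) has_integral (- cos (\<omega> * v + \<theta>) / \<omega> - - cos (\<omega> * u + \<theta>) / \<omega>)) {u..v}"
      using that \<open>\<omega> \<noteq> 0\<close>
      by (intro fundamental_theorem_of_calculus[where f = "\<lambda>x. - cos (\<omega> * x + \<theta>) / \<omega>"])
        (auto intro!: derivative_eq_intros simp flip: has_real_derivative_iff_has_vector_derivative)
    then have "\<bar>integral {u..v} (\<lambda>x. sin (\<omega> * x + \<theta>))\<bar> = \<bar>cos (\<omega> * u + \<theta>) - cos (\<omega> * v + \<theta>)\<bar> / \<bar>\<omega>\<bar>"
      by (simp add: integral_unique diff_divide_distrib[symmetric] flip: abs_divide)
    also have "\<dots> \<le> 2 / \<bar>\<omega>\<bar>"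
      using abs_cos_le_one[of "\<omega> * u + \<theta>"] abs_cos_le_one[of "\<omega> * v + \<theta>"]
      by (intro divide_right_mono) linarith+
    finally show ?thesis .
  qed
  have int: "(\<lambda>x. sin (\<omega> * x + \<theta>)) integrable_on {c..d}"
    by (intro integrable_continuous_real continuous_intros)
  obtain m where m: "m \<in> {c..d}" "((\<lambda>x. g x * sin (\<omega> * x + \<theta>)) has_integral
      (g c * integral {c..m} (\<lambda>x. sin (\<omega> * x + \<theta>)) + g d * integral {m..d} (\<lambda>x. sin (\<omega> * x + \<theta>)))) {c..d}"
    using second_mean_value_theorem_full[OF int \<open>c \<le> d\<close>, of g] mono_onD[OF g] by auto
  show "(\<lambda>x. g x * sin (\<omega> * x + \<theta>)) integrable_on {c..d}"
    using m(2) by blast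
  have "\<bar>integral {c..d} (\<lambda>x. g x * sin (\<omega> * x + \<theta>))\<bar>
      \<le> \<bar>g c\<bar> * \<bar>integral {c..m} (\<lambda>x. sin (\<omega> * x + \<theta>))\<bar> + \<bar>g d\<bar> * \<bar>integral {m..d} (\<lambda>x. sin (\<omega> * x + \<theta>))\<bar>"
    unfolding integral_unique[OF m(2)] by (metis abs_mult abs_triangle_ineq)
  also have "\<dots> \<le> s * (2 / \<bar>\<omega>\<bar>) + s * (2 / \<bar>\<omega>\<bar>)"
    using m(1) s by (intro add_mono mult_mono sin) auto
  finally show "\<bar>integral {c..d} (\<lambda>x. g x * sin (\<omega> * x + \<theta>))\<bar> \<le> s * (4 / \<bar>\<omega>\<bar>)"
    by (simp add: mult.commute)
qed

text \<open>
  Dirichlet's test.  Both monotone parts of \<open>f\<close> converge at infinity, and since \<open>f\<close> is integrable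
  their limits agree; subtracting the common limit writes \<open>f\<close> as a difference of monotone functions
  that tend to \<open>0\<close>.  For each of them the tails against the sine are small.  These tails are
  Henstock-Kurzweil integrals, which agree with the Laplace integrals as the integrand is bounded.
\<close>

lemma has_Laplace_integral_atLeast_mult_sin_if_BV:
  assumes I: "has_Laplace_integral_atLeast f p I" and bv: "bounded_variation_on {a..} f" and "\<omega> \<noteq> 0"
  shows "\<exists>J. has_Laplace_integral_atLeast (\<lambda>x. f x * sin (\<omega> * x + \<theta>)) p J"
proof (rule has_Laplace_integral_atLeast_if_small_tails)
  have f: "\<And>c. p \<le> c \<Longrightarrow> Laplace_integrable f p c"
    using I by (auto simp: has_Laplace_integral_atLeast_def)
  show fs: "Laplace_integrable (\<lambda>x. f x * sin (\<omega> * x + \<theta>)) p c" if "p \<le> c" for c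
    by (rule Laplace_integrable_mult_sin[OF that f[OF that]])
  obtain g h B where g: "mono_on {a..} g" and h: "mono_on {a..} h"
    and fgh: "\<And>x. x \<ge> a \<Longrightarrow> f x = g x - h x"
    and B: "\<And>x. x \<ge> a \<Longrightarrow> \<bar>g x\<bar> \<le> B" "\<And>x. x \<ge> a \<Longrightarrow> \<bar>h x\<bar> \<le> B"
    using bounded_variation_on_atLeast_decompose[OF bv] by metis
  have "g x \<le> B" "h x \<le> B" if "x \<ge> a" for x
    using B[OF that] by auto
  then obtain K L where K: "(g \<longlongrightarrow> K) at_top" and L: "(h \<longlongrightarrow> L) at_top"
    using mono_on_bounded_tendsto_at_top[OF g] mono_on_bounded_tendsto_at_top[OF h] by metis
  have "(f \<longlongrightarrow> K - L) at_top"
    by (rule Lim_transform_eventually[OF tendsto_diff[OF K L]])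
      (use fgh in \<open>auto simp: eventually_at_top_linorder intro!: exI[of _ a]\<close>)
  from tendsto_0_if_has_Laplace_integral_atLeast[OF I this] have KL: "K = L" by simp
  define g' where "g' x = g x - K" for x
  define h' where "h' x = h x - K" for x
  have mono: "mono_on {c..d} g'" "mono_on {c..d} h'" if "a \<le> c" for c d
    using g h that by (auto simp: mono_on_def g'_def h'_def)
  have fgh': "f x = g' x - h' x" if "x \<ge> a" for x
    using fgh[OF that] by (simp add: g'_def h'_def)
  fix e :: real assume e: "e > 0"
  \<comment> \<open>the two monotone parts contribute \<open>4 s / \<bar>\<omega>\<bar>\<close> each, in total \<open>e / 2\<close>\<close>
  define s where "s = e * \<bar>\<omega>\<bar> / 16"
  have s: "s > 0" using e \<open>\<omega> \<noteq> 0\<close> by (simp add: s_def)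
  have "\<forall>\<^sub>F x in at_top. \<bar>g' x\<bar> \<le> s \<and> \<bar>h' x\<bar> \<le> s"
    using tendstoD[OF K s] tendstoD[OF L s]
    by eventually_elim (simp add: g'_def h'_def dist_real_def KL)
  then obtain C where C: "\<And>x. C \<le> x \<Longrightarrow> \<bar>g' x\<bar> \<le> s" "\<And>x. C \<le> x \<Longrightarrow> \<bar>h' x\<bar> \<le> s"
    by (auto simp: eventually_at_top_linorder)
  let ?S = "\<lambda>x. sin (\<omega> * x + \<theta>)"
  show "\<exists>C. \<forall>c d. p \<le> c \<longrightarrow> C \<le> c \<longrightarrow> c \<le> d \<longrightarrow> \<bar>Laplace_integral (\<lambda>x. f x * ?S x) c d\<bar> < e"
  proof (rule exI[of _ "max a C"], intro allI impI)
    fix c d assume cd: "p \<le> c" "max a C \<le> c" "c \<le> d"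
    then have "a \<le> c" "C \<le> c" "C \<le> d" by auto
    note G = abs_integral_mono_mult_sin_le[OF mono(1)[OF \<open>a \<le> c\<close>] cd(3) \<open>\<omega> \<noteq> 0\<close>
        C(1)[OF \<open>C \<le> c\<close>] C(1)[OF \<open>C \<le> d\<close>], of \<theta>]
    note H = abs_integral_mono_mult_sin_le[OF mono(2)[OF \<open>a \<le> c\<close>] cd(3) \<open>\<omega> \<noteq> 0\<close>
        C(2)[OF \<open>C \<le> c\<close>] C(2)[OF \<open>C \<le> d\<close>], of \<theta>]
    have eq: "f x * ?S x = g' x * ?S x - h' x * ?S x" if "x \<in> {c..d}" for x
      using fgh'[of x] that \<open>a \<le> c\<close> by (simp add: left_diff_distrib)
    have int: "((\<lambda>x. f x * ?S x) has_integral
        (integral {c..d} (\<lambda>x. g' x * ?S x) - integral {c..d} (\<lambda>x. h' x * ?S x))) {c..d}"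
      by (rule has_integral_eq[OF _ has_integral_diff[OF integrable_integral[OF G(1)] integrable_integral[OF H(1)]]])
        (simp add: eq)
    have "Laplace_integral (\<lambda>x. f x * ?S x) c d = integral {c..d} (\<lambda>x. f x * ?S x)"
    proof (rule Laplace_integral_eq_integral_if_bounded[OF cd(3), where M = "2 * s"])
      show "Laplace_integrable (\<lambda>x. f x * ?S x) c d"
        by (rule Laplace_integrable_restrict[OF fs[of d]]) (use cd in auto)
      show "(\<lambda>x. f x * ?S x) integrable_on {c..d}" using int by blast
      fix x assume x: "x \<in> {c..d}"
      have "\<bar>f x * ?S x\<bar> \<le> \<bar>f x\<bar>" by (simp add: abs_mult mult_left_le)
      also have "\<dots> \<le> 2 * s"
        using C[of x] fgh'[of x] x \<open>a \<le> c\<close> \<open>C \<le> c\<close> by auto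
      finally show "\<bar>f x * ?S x\<bar> \<le> 2 * s" .
    qed
    also have "\<bar>integral {c..d} (\<lambda>x. f x * ?S x)\<bar> \<le> s * (4 / \<bar>\<omega>\<bar>) + s * (4 / \<bar>\<omega>\<bar>)"
      unfolding integral_unique[OF int] using G(2) H(2) by linarith
    also have "\<dots> < e"
      using e \<open>\<omega> \<noteq> 0\<close> by (simp add: s_def)
    finally show "\<bar>Laplace_integral (\<lambda>x. f x * ?S x) c d\<bar> < e" .
  qed
qed

section \<open>Existence of the Fourier transform\<close>

text \<open>
  Reflection turns the tail at \<open>- \<infinity>\<close> into one at \<open>\<infinity>\<close>, so the two convergence tests above serve for both.
\<close>

lemma has_Laplace_integral_atMost_iff_reflect:
  "has_Laplace_integral_atMost f q I \<longleftrightarrow> has_Laplace_integral_atLeast (\<lambda>x. f (- x)) (- q) I"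
proof -
  have *: "has_Laplace_integral f c q J \<longleftrightarrow> has_Laplace_integral (\<lambda>x. f (- x)) (- q) (- c) J" if "c \<le> q" for c J
    using has_Laplace_integral_reflect[OF that, of f J]
      has_Laplace_integral_reflect[of "- q" "- c" "\<lambda>x. f (- x)" J] that by auto
  have 1: "(\<forall>c\<le>q. Laplace_integrable f c q) \<longleftrightarrow> (\<forall>c\<ge>- q. Laplace_integrable (\<lambda>x. f (- x)) (- q) c)"
  proof (intro iffI allI impI)
    fix c assume "\<forall>c\<le>q. Laplace_integrable f c q" "- q \<le> c"
    then have "Laplace_integrable f (- c) q" "- c \<le> q" by auto
    then show "Laplace_integrable (\<lambda>x. f (- x)) (- q) c"
      using *[of "- c"] by (simp add: Laplace_integrable_def)
  next
    fix c assume "\<forall>c\<ge>- q. Laplace_integrable (\<lambda>x. f (- x)) (- q) c" "c \<le> q"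
    then have "Laplace_integrable (\<lambda>x. f (- x)) (- q) (- c)" by auto
    then show "Laplace_integrable f c q"
      using *[OF \<open>c \<le> q\<close>] by (simp add: Laplace_integrable_def)
  qed
  have eq: "Laplace_integral f c q = Laplace_integral (\<lambda>x. f (- x)) (- q) (- c)" if "c \<le> q" for c
    unfolding Laplace_integral_def by (rule arg_cong[where f = The]) (rule ext, rule *[OF that])
  have "((\<lambda>c. Laplace_integral f c q) \<longlongrightarrow> I) at_bot \<longleftrightarrow>
      ((\<lambda>c. Laplace_integral f (- c) q) \<longlongrightarrow> I) at_top"
    by (simp add: filterlim_at_bot_mirror)
  also have "\<dots> \<longleftrightarrow> ((\<lambda>c. Laplace_integral (\<lambda>x. f (- x)) (- q) c) \<longlongrightarrow> I) at_top"
  proof (rule tendsto_cong)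
    show "\<forall>\<^sub>F c in at_top. Laplace_integral f (- c) q = Laplace_integral (\<lambda>x. f (- x)) (- q) c"
      using eventually_ge_at_top[of "- q"] by eventually_elim (simp add: eq)
  qed
  finally show ?thesis
    using 1 by (simp add: has_Laplace_integral_atMost_def has_Laplace_integral_atLeast_def)
qed

lemma has_Laplace_integral_UNIV_if_halves:
  assumes "\<exists>I. has_Laplace_integral_atLeast f p I"
    and "\<exists>I. has_Laplace_integral_atLeast (\<lambda>x. f (- x)) (- p) I"
  shows "\<exists>I. has_Laplace_integral_UNIV f I"
  using assms unfolding has_Laplace_integral_UNIV_def has_Laplace_integral_atMost_iff_reflect by blast

text \<open>
  The phase \<open>\<theta>\<close> covers the real and the imaginary part of the kernel at once, and the functions
  \<open>sin (\<omega> x + \<theta>)\<close> are permuted by the reflection \<open>x \<mapsto> - x\<close>.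
\<close>

lemma has_Fourier_transform_if_sin_integrals:
  assumes "\<And>\<theta>. \<exists>I. has_Laplace_integral_UNIV (\<lambda>x. f x * sin (- (2 * pi * y) * x + \<theta>)) I"
  shows "\<exists>w. has_Fourier_transform f y w"
proof -
  obtain A where A: "has_Laplace_integral_UNIV (\<lambda>x. f x * sin (- (2 * pi * y) * x + pi / 2)) A"
    using assms by blast
  obtain B where B: "has_Laplace_integral_UNIV (\<lambda>x. f x * sin (- (2 * pi * y) * x + 0)) B"
    using assms by blast
  have kernel: "exp (- 2 * complex_of_real pi * \<i> * complex_of_real y * complex_of_real x)
      = cis (- (2 * pi * y) * x)" for x
    by (simp add: cis_conv_exp mult_ac)
  have "sin (- (2 * pi * y) * x + pi / 2) = cos (- (2 * pi * y) * x)" for x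
    using cos_sin_eq[of "2 * pi * y * x"] by simp
  then have "has_Fourier_transform f y (Complex A B)"
    using A B unfolding has_Fourier_transform_def has_complex_Laplace_integral_UNIV_def kernel by simp
  then show ?thesis by blast
qed

lemma Fourier_transform_exists_if_Lebesgue:
  assumes f: "f \<in> LP_loc" and a: "set_integrable lebesgue (UNIV - {-a<..<a}) f"
  shows "\<exists>w. has_Fourier_transform f y w"
proof (rule has_Fourier_transform_if_sin_integrals, rule has_Laplace_integral_UNIV_if_halves[where p = 0])
  fix \<theta> :: real
  define b where "b = max a 0"
  have f_int: "Laplace_integrable f p q" if "p \<le> q" for p q
    using f that by (auto simp: LP_loc_def)
  have right: "set_integrable lebesgue {b..} f"
    by (rule set_integrable_subset[OF a]) (auto simp: b_def)
  have "set_integrable lebesgue {..- b} f"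
    by (rule set_integrable_subset[OF a]) (auto simp: b_def)
  then have left: "set_integrable lebesgue {b..} (\<lambda>x. f (- x))"
    using has_absolute_integral_reflect_real[of "{b..}" "{..- b}" f "integral {..- b} f"] by auto
  show "\<exists>I. has_Laplace_integral_atLeast (\<lambda>x. f x * sin (- (2 * pi * y) * x + \<theta>)) 0 I"
    by (rule has_Laplace_integral_atLeast_mult_sin_if_Lebesgue[OF f_int right])
  have "Laplace_integrable (\<lambda>x. f (- x)) 0 c" if "0 \<le> c" for c
    using has_Laplace_integral_reflect[of "- c" 0 f] f_int[of "- c" 0] that
    by (auto simp: Laplace_integrable_def)
  from has_Laplace_integral_atLeast_mult_sin_if_Lebesgue[OF this left, of "2 * pi * y"]
  show "\<exists>I. has_Laplace_integral_atLeast (\<lambda>x. f (- x) * sin (- (2 * pi * y) * - x + \<theta>)) (- 0) I"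
    by simp
qed

text \<open>
  At \<open>y = 0\<close> the kernel does not oscillate and the test of Dirichlet is void; there the real part of
  the integrand is \<open>f\<close> itself, which is integrable by assumption, and the imaginary part is \<open>0\<close>.
\<close>

lemma Fourier_transform_exists_if_BV:
  assumes f: "f \<in> LP \<inter> BV_infinity"
  shows "\<exists>w. has_Fourier_transform f y w"
proof -
  obtain p A B where "has_Laplace_integral_atMost f p A" and right: "has_Laplace_integral_atLeast f p B"
    using f by (auto simp: LP_def has_Laplace_integral_UNIV_def)
  then have left: "has_Laplace_integral_atLeast (\<lambda>x. f (- x)) (- p) A"
    by (simp add: has_Laplace_integral_atMost_iff_reflect)
  obtain a where bv: "bounded_variation_on (UNIV - {-a<..<a}) f"
    using f by (auto simp: BV_infinity_def)
  define b where "b = max a 0"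
  have sub: "{b..} \<subseteq> UNIV - {-a<..<a}" by (auto simp: b_def)
  have bv_right: "bounded_variation_on {b..} f"
    by (rule bounded_variation_on_subset[OF bv sub])
  have "bounded_variation_on (UNIV - {-a<..<a}) (\<lambda>x. f (- x))"
    by (rule bounded_variation_on_reflect[OF bv]) auto
  then have bv_left: "bounded_variation_on {b..} (\<lambda>x. f (- x))"
    by (rule bounded_variation_on_subset[OF _ sub])
  show ?thesis
  proof (cases "y = 0")
    case True
    \<comment> \<open>\<open>0 = g + (- g)\<close> is integrable wherever \<open>g\<close> is\<close>
    have 0: "Laplace_integrable (\<lambda>x. 0) q c" if "q \<le> c" "Laplace_integrable g q c" for g q c
      using Laplace_integrable_add[OF that(1) that(2) Laplace_integrable_uminus[OF that]] by simp
    have "Laplace_integrable (\<lambda>x. 0) p c" if "p \<le> c" for c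
      using 0[OF that] right that by (auto simp: has_Laplace_integral_atLeast_def)
    from has_Laplace_integral_atLeast_mult_sin_if_Lebesgue[OF this, of 0 0 0]
    have zero_right: "\<exists>I. has_Laplace_integral_atLeast (\<lambda>x. 0) p I"
      by (simp add: set_integrable_def)
    have "Laplace_integrable (\<lambda>x. 0) (- p) c" if "- p \<le> c" for c
      using 0[OF that] left that by (auto simp: has_Laplace_integral_atLeast_def)
    from has_Laplace_integral_atLeast_mult_sin_if_Lebesgue[OF this, of 0 0 0]
    have zero_left: "\<exists>I. has_Laplace_integral_atLeast (\<lambda>x. 0) (- p) I"
      by (simp add: set_integrable_def)
    obtain Z where "has_Laplace_integral_UNIV (\<lambda>x. 0) Z"
      using has_Laplace_integral_UNIV_if_halves[OF zero_right] zero_left by auto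
    moreover obtain J where "has_Laplace_integral_UNIV f J"
      using f by (auto simp: LP_def)
    ultimately have "has_Fourier_transform f y (Complex J Z)"
      by (simp add: True has_Fourier_transform_def has_complex_Laplace_integral_UNIV_def)
    then show ?thesis by blast
  next
    case False
    show ?thesis
    proof (rule has_Fourier_transform_if_sin_integrals, rule has_Laplace_integral_UNIV_if_halves[where p = p])
      fix \<theta> :: real
      show "\<exists>I. has_Laplace_integral_atLeast (\<lambda>x. f x * sin (- (2 * pi * y) * x + \<theta>)) p I"
        using False by (intro has_Laplace_integral_atLeast_mult_sin_if_BV[OF right bv_right]) simp
      have "\<exists>I. has_Laplace_integral_atLeast (\<lambda>x. f (- x) * sin ((2 * pi * y) * x + \<theta>)) (- p) I"
        using False by (intro has_Laplace_integral_atLeast_mult_sin_if_BV[OF left bv_left]) simp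
      then show "\<exists>I. has_Laplace_integral_atLeast (\<lambda>x. f (- x) * sin (- (2 * pi * y) * - x + \<theta>)) (- p) I"
        by simp
    qed
  qed
qed

theorem theorem6p1:
  fixes f :: "real \<Rightarrow> real"
  shows "(f \<in> LP_loc \<and> (\<exists>a>0. set_integrable lebesgue (UNIV - {-a<..<a}) f)
            \<longrightarrow> (\<forall>y. \<exists>w. has_Fourier_transform f y w)) \<and>
         (f \<in> LP \<inter> BV_infinity
            \<longrightarrow> (\<forall>y. \<exists>w. has_Fourier_transform f y w))"
  using Fourier_transform_exists_if_Lebesgue Fourier_transform_exists_if_BV by blast

end
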